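(* Let $R$ be a commutative ring with $1$, let $m\ge 0$ and $n\ge 1$ be integers, and let $E^m$ be the Grassmann algebra of rank $m$ over $R$. Then the standard identity of degree $$2\left(\left\lfloor\frac{n^2+1}{2}\right\rfloor+\left\lfloor\frac m2\right\rfloor\right)$$ holds in the ring $M_nE^m$ of $n\times n$ matrices over $E^m$.
   Context: The Grassmann algebra of rank $m$ over $R$ is the $R$-algebra $E^m=R\langle v_1,\dots,v_m\rangle/(v_k^2,\ v_iv_j+v_jv_i\mid 1\le k\le m,\ 1\le i<j\le m)$. The standard polynomial $s_k$ is the polynomial in noncommuting variables $$s_k(x_1,\dots,x_k)=\sum_{\pi\in\mathfrak S_k}(-1)^\pi\, x_{\pi(1)}x_{\pi(2)}\cdots x_{\pi(k)},$$ where $\mathfrak S_k$ is the symmetric group on $\{1,\dots,k\}$ and $(-1)^\pi$ is the sign of $\pi$. The standard identity of degree $k$ holds in a ring $\mathfrak A$ if $s_k(x_1,\dots,x_k)=0$ for all $x_1,\dots,x_k\in\mathfrak A$. *)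

theory Defs
  imports "HOL-Combinatorics.Permutations" "HOL-Algebra.QuotRing"
begin

section \<open>Free associative algebras\<close>

text \<open>
  An element of \<open>R\<langle>X\<rangle>\<close> is its coefficient function on words over \<open>X\<close>: a function of finite
  support that vanishes outside the words over \<open>X\<close>. The product is the convolution over all
  ways of splitting a word in two.
\<close>

definition free_algebra :: "('a, 'b) ring_scheme \<Rightarrow> 'v set \<Rightarrow> ('v list \<Rightarrow> 'a) ring" where
  "free_algebra R X =
    \<lparr>carrier = {f. range f \<subseteq> carrier R \<and> finite {w. f w \<noteq> \<zero>\<^bsub>R\<^esub>} \<and> {w. f w \<noteq> \<zero>\<^bsub>R\<^esub>} \<subseteq> lists X},
     mult = (\<lambda>f g w. \<Oplus>\<^bsub>R\<^esub>i\<in>{..length w}. f (take i w) \<otimes>\<^bsub>R\<^esub> g (drop i w)),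
     one = (\<lambda>w. if w = [] then \<one>\<^bsub>R\<^esub> else \<zero>\<^bsub>R\<^esub>),
     zero = (\<lambda>w. \<zero>\<^bsub>R\<^esub>),
     add = (\<lambda>f g w. f w \<oplus>\<^bsub>R\<^esub> g w)\<rparr>"

definition free_gen :: "('a, 'b) ring_scheme \<Rightarrow> 'v \<Rightarrow> 'v list \<Rightarrow> 'a" where
  "free_gen R x = (\<lambda>w. if w = [x] then \<one>\<^bsub>R\<^esub> else \<zero>\<^bsub>R\<^esub>)"


section \<open>Grassmann algebras\<close>

definition grassmann_relations :: "('a, 'b) ring_scheme \<Rightarrow> nat \<Rightarrow> (nat list \<Rightarrow> 'a) set" where
  "grassmann_relations R m =
    (let F = free_algebra R {1..m}; v = free_gen R in
      {v k \<otimes>\<^bsub>F\<^esub> v k | k. 1 \<le> k \<and> k \<le> m} \<union>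
      {v i \<otimes>\<^bsub>F\<^esub> v j \<oplus>\<^bsub>F\<^esub> v j \<otimes>\<^bsub>F\<^esub> v i | i j. 1 \<le> i \<and> i < j \<and> j \<le> m})"

text \<open>\<open>Idl\<close> is the generated two-sided ideal; it is automatically stable under scalars from \<open>R\<close>.\<close>

definition grassmann_algebra :: "('a, 'b) ring_scheme \<Rightarrow> nat \<Rightarrow> (nat list \<Rightarrow> 'a) set ring" where
  "grassmann_algebra R m =
    free_algebra R {1..m} Quot (Idl\<^bsub>free_algebra R {1..m}\<^esub> (grassmann_relations R m))"


section \<open>Matrix rings\<close>

text \<open>
  The entries come from an arbitrary, possibly noncommutative, ring; a matrix is an extensional
  function on the index pairs.
\<close>

definition matrix_ring :: "nat \<Rightarrow> ('a, 'b) ring_scheme \<Rightarrow> (nat \<times> nat \<Rightarrow> 'a) ring" where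
  "matrix_ring n A =
    \<lparr>carrier = {1..n} \<times> {1..n} \<rightarrow>\<^sub>E carrier A,
     mult = (\<lambda>M N. \<lambda>(i, j)\<in>{1..n} \<times> {1..n}. \<Oplus>\<^bsub>A\<^esub>l\<in>{1..n}. M (i, l) \<otimes>\<^bsub>A\<^esub> N (l, j)),
     one = (\<lambda>(i, j)\<in>{1..n} \<times> {1..n}. if i = j then \<one>\<^bsub>A\<^esub> else \<zero>\<^bsub>A\<^esub>),
     zero = (\<lambda>(i, j)\<in>{1..n} \<times> {1..n}. \<zero>\<^bsub>A\<^esub>),
     add = (\<lambda>M N. \<lambda>(i, j)\<in>{1..n} \<times> {1..n}. M (i, j) \<oplus>\<^bsub>A\<^esub> N (i, j))\<rparr>"


section \<open>Standard identities\<close>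

text \<open>The \<open>foldr\<close> is the ordered product \<open>x (p 1) \<otimes> x (p 2) \<otimes> \<dots> \<otimes> x (p k)\<close>.\<close>

definition standard_poly :: "('a, 'b) ring_scheme \<Rightarrow> nat \<Rightarrow> (nat \<Rightarrow> 'a) \<Rightarrow> 'a" where
  "standard_poly A k x =
    (\<Oplus>\<^bsub>A\<^esub>p\<in>{p. p permutes {1..k}}.
      [sign p] \<cdot>\<^bsub>A\<^esub> foldr (\<lambda>i y. x (p i) \<otimes>\<^bsub>A\<^esub> y) [1..<Suc k] \<one>\<^bsub>A\<^esub>)"

definition standard_identity :: "('a, 'b) ring_scheme \<Rightarrow> nat \<Rightarrow> bool" where
  "standard_identity A k \<longleftrightarrow>
    (\<forall>x. x \<in> {1..k} \<rightarrow> carrier A \<longrightarrow> standard_poly A k x = \<zero>\<^bsub>A\<^esub>)"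


section \<open>The constructions above yield rings\<close>

lemma (in abelian_monoid) finsum_triangle:
  fixes n :: nat
  assumes "\<And>i j. F i j \<in> carrier G"
  shows "(\<Oplus>i\<in>{..n}. \<Oplus>j\<in>{..i}. F j i) = (\<Oplus>j\<in>{..n}. \<Oplus>k\<in>{..n - j}. F j (j + k))"
proof (induction n)
  case 0
  then show ?case by (simp add: assms)
next
  case (Suc n)
  have "(\<Oplus>j\<in>{..n}. \<Oplus>k\<in>{..Suc n - j}. F j (j + k))
      = (\<Oplus>j\<in>{..n}. F j (Suc n) \<oplus> (\<Oplus>k\<in>{..n - j}. F j (j + k)))"
    by (intro finsum_cong') (auto simp: Suc_diff_le assms)
  also have "\<dots> = (\<Oplus>j\<in>{..n}. F j (Suc n)) \<oplus> (\<Oplus>i\<in>{..n}. \<Oplus>j\<in>{..i}. F j i)"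
    by (simp add: finsum_addf assms Suc.IH)
  finally show ?case
    by (simp add: assms a_assoc)
qed

lemma (in abelian_monoid) finsum_commute:
  assumes "finite S" "finite T" "\<And>i j. i \<in> S \<Longrightarrow> j \<in> T \<Longrightarrow> F i j \<in> carrier G"
  shows "(\<Oplus>i\<in>S. \<Oplus>j\<in>T. F i j) = (\<Oplus>j\<in>T. \<Oplus>i\<in>S. F i j)"
  using assms(1,3)
proof (induction S rule: finite_induct)
  case empty
  then show ?case by simp
next
  case (insert a S)
  have "(\<Oplus>j\<in>T. \<Oplus>i\<in>insert a S. F i j) = (\<Oplus>j\<in>T. F a j \<oplus> (\<Oplus>i\<in>S. F i j))"
    using insert by (intro finsum_cong') (auto simp: Pi_def)
  also have "\<dots> = (\<Oplus>j\<in>T. F a j) \<oplus> (\<Oplus>j\<in>T. \<Oplus>i\<in>S. F i j)"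
    using insert by (intro finsum_addf) (auto simp: Pi_def)
  finally show ?case
    using insert by (auto simp: Pi_def)
qed

lemma (in ring) ring_free_algebra: "ring (free_algebra R X)" (is "ring ?F")
proof -
  have mem: "f w \<in> carrier R" if "f \<in> carrier ?F" for f w
    using that by (auto simp: free_algebra_def)
  have carI: "f \<in> carrier ?F"
    if "\<And>w. f w \<in> carrier R" "{w. f w \<noteq> \<zero>} \<subseteq> S" "finite S" "S \<subseteq> lists X" for f S
    using that by (auto simp: free_algebra_def intro: finite_subset)
  have supp: "finite {w. f w \<noteq> \<zero>}" "{w. f w \<noteq> \<zero>} \<subseteq> lists X" if "f \<in> carrier ?F" for f
    using that by (auto simp: free_algebra_def)
  have add_cl: "f \<oplus>\<^bsub>?F\<^esub> g \<in> carrier ?F" if fg: "f \<in> carrier ?F" "g \<in> carrier ?F" for f g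
  proof (rule carI)
    show "{w. (f \<oplus>\<^bsub>?F\<^esub> g) w \<noteq> \<zero>} \<subseteq> {w. f w \<noteq> \<zero>} \<union> {w. g w \<noteq> \<zero>}"
      by (auto simp: free_algebra_def)
    show "(f \<oplus>\<^bsub>?F\<^esub> g) w \<in> carrier R" for w
      using mem[OF fg(1), of w] mem[OF fg(2), of w] by (simp add: free_algebra_def)
    show "finite ({w. f w \<noteq> \<zero>} \<union> {w. g w \<noteq> \<zero>})"
      using supp(1)[OF fg(1)] supp(1)[OF fg(2)] by simp
    show "{w. f w \<noteq> \<zero>} \<union> {w. g w \<noteq> \<zero>} \<subseteq> lists X"
      using supp(2)[OF fg(1)] supp(2)[OF fg(2)] by (rule Un_least)
  qed
  have mult_cl: "f \<otimes>\<^bsub>?F\<^esub> g \<in> carrier ?F" if fg: "f \<in> carrier ?F" "g \<in> carrier ?F" for f g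
  proof (rule carI)
    let ?S = "(\<lambda>(u, v). u @ v) ` ({w. f w \<noteq> \<zero>} \<times> {w. g w \<noteq> \<zero>})"
    show "(f \<otimes>\<^bsub>?F\<^esub> g) w \<in> carrier R" for w
      using mem[OF fg(1)] mem[OF fg(2)] by (simp add: free_algebra_def Pi_def)
    show "{w. (f \<otimes>\<^bsub>?F\<^esub> g) w \<noteq> \<zero>} \<subseteq> ?S"
    proof (rule subsetI, rule ccontr)
      fix w assume w: "w \<in> {w. (f \<otimes>\<^bsub>?F\<^esub> g) w \<noteq> \<zero>}" and nS: "w \<notin> ?S"
      have "f (take i w) \<otimes> g (drop i w) = \<zero>" for i
      proof (rule ccontr)
        assume a: "f (take i w) \<otimes> g (drop i w) \<noteq> \<zero>"
        then have "f (take i w) \<noteq> \<zero>" "g (drop i w) \<noteq> \<zero>"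
          using mem[OF fg(1)] mem[OF fg(2)] by auto
        then have "w \<in> ?S"
          by (auto intro!: image_eqI[of _ _ "(take i w, drop i w)"])
        with nS show False by simp
      qed
      with w show False by (simp add: free_algebra_def)
    qed
    show "finite ?S"
      using supp(1)[OF fg(1)] supp(1)[OF fg(2)] by simp
    show "?S \<subseteq> lists X"
      using supp(2)[OF fg(1)] supp(2)[OF fg(2)] by (auto simp: subset_iff in_lists_conv_set)
  qed
  show ?thesis
  proof (rule ringI)
    show "abelian_group ?F"
    proof (rule abelian_groupI)
      fix f assume f: "f \<in> carrier ?F"
      have "(\<lambda>w. \<ominus> f w) \<in> carrier ?F"
        by (rule carI[where S = "{w. f w \<noteq> \<zero>}"]) (use supp[OF f] mem[OF f] in auto)
      then show "\<exists>g\<in>carrier ?F. g \<oplus>\<^bsub>?F\<^esub> f = \<zero>\<^bsub>?F\<^esub>"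
        using mem[OF f]
        by (intro bexI[where x = "\<lambda>w. \<ominus> f w"]) (simp_all add: free_algebra_def l_neg)
      show "\<zero>\<^bsub>?F\<^esub> \<oplus>\<^bsub>?F\<^esub> f = f"
        using mem[OF f] by (auto simp: free_algebra_def)
    next
      show "\<zero>\<^bsub>?F\<^esub> \<in> carrier ?F" by (auto simp: free_algebra_def)
    next
      fix f g assume fg: "f \<in> carrier ?F" "g \<in> carrier ?F"
      show "f \<oplus>\<^bsub>?F\<^esub> g = g \<oplus>\<^bsub>?F\<^esub> f"
        using mem[OF fg(1)] mem[OF fg(2)] by (auto simp: free_algebra_def a_comm)
      fix h assume h: "h \<in> carrier ?F"
      show "f \<oplus>\<^bsub>?F\<^esub> g \<oplus>\<^bsub>?F\<^esub> h = f \<oplus>\<^bsub>?F\<^esub> (g \<oplus>\<^bsub>?F\<^esub> h)"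
        using mem[OF fg(1)] mem[OF fg(2)] mem[OF h] by (auto simp: free_algebra_def a_assoc)
    qed (rule add_cl)
    show "monoid ?F"
    proof (rule monoidI)
      show "\<one>\<^bsub>?F\<^esub> \<in> carrier ?F"
        by (rule carI[where S = "{[]}"]) (auto simp: free_algebra_def)
    next
      fix f assume f: "f \<in> carrier ?F"
      note [simp] = mem[OF f]
      show "\<one>\<^bsub>?F\<^esub> \<otimes>\<^bsub>?F\<^esub> f = f"
      proof
        fix w
        have "(\<one>\<^bsub>?F\<^esub> \<otimes>\<^bsub>?F\<^esub> f) w = (\<Oplus>i\<in>{..length w}. if 0 = i then f (drop i w) else \<zero>)"
          unfolding free_algebra_def by (auto intro!: finsum_cong')
        also have "\<dots> = f w"
          by (subst finsum_singleton) auto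
        finally show "(\<one>\<^bsub>?F\<^esub> \<otimes>\<^bsub>?F\<^esub> f) w = f w" .
      qed
      show "f \<otimes>\<^bsub>?F\<^esub> \<one>\<^bsub>?F\<^esub> = f"
      proof
        fix w
        have "(f \<otimes>\<^bsub>?F\<^esub> \<one>\<^bsub>?F\<^esub>) w = (\<Oplus>i\<in>{..length w}. if length w = i then f (take i w) else \<zero>)"
          unfolding free_algebra_def by (auto intro!: finsum_cong')
        also have "\<dots> = f w"
          by (subst finsum_singleton) auto
        finally show "(f \<otimes>\<^bsub>?F\<^esub> \<one>\<^bsub>?F\<^esub>) w = f w" .
      qed
    next
      fix f g h assume fgh: "f \<in> carrier ?F" "g \<in> carrier ?F" "h \<in> carrier ?F"
      note [simp] = fgh[THEN mem]
      show "f \<otimes>\<^bsub>?F\<^esub> g \<otimes>\<^bsub>?F\<^esub> h = f \<otimes>\<^bsub>?F\<^esub> (g \<otimes>\<^bsub>?F\<^esub> h)"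
      proof
        fix w
        let ?T = "\<lambda>j i. f (take j w) \<otimes> (g (take (i - j) (drop j w)) \<otimes> h (drop i w))"
        have "(f \<otimes>\<^bsub>?F\<^esub> g \<otimes>\<^bsub>?F\<^esub> h) w = (\<Oplus>i\<in>{..length w}. \<Oplus>j\<in>{..i}. ?T j i)"
          by (auto simp: free_algebra_def finsum_ldistr Pi_def m_assoc drop_take
              intro!: finsum_cong')
        also have "\<dots> = (\<Oplus>j\<in>{..length w}. \<Oplus>k\<in>{..length w - j}. ?T j (j + k))"
          by (rule finsum_triangle) simp
        also have "\<dots> = (f \<otimes>\<^bsub>?F\<^esub> (g \<otimes>\<^bsub>?F\<^esub> h)) w"
          by (auto simp: free_algebra_def finsum_rdistr Pi_def add.commute
              intro!: finsum_cong')
        finally show "(f \<otimes>\<^bsub>?F\<^esub> g \<otimes>\<^bsub>?F\<^esub> h) w = (f \<otimes>\<^bsub>?F\<^esub> (g \<otimes>\<^bsub>?F\<^esub> h)) w" .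
      qed
    qed (rule mult_cl)
  next
    fix f g h assume fgh: "f \<in> carrier ?F" "g \<in> carrier ?F" "h \<in> carrier ?F"
    note [simp] = fgh[THEN mem]
    show "(f \<oplus>\<^bsub>?F\<^esub> g) \<otimes>\<^bsub>?F\<^esub> h = f \<otimes>\<^bsub>?F\<^esub> h \<oplus>\<^bsub>?F\<^esub> g \<otimes>\<^bsub>?F\<^esub> h"
      by (auto simp: free_algebra_def l_distr finsum_addf Pi_def)
    show "h \<otimes>\<^bsub>?F\<^esub> (f \<oplus>\<^bsub>?F\<^esub> g) = h \<otimes>\<^bsub>?F\<^esub> f \<oplus>\<^bsub>?F\<^esub> h \<otimes>\<^bsub>?F\<^esub> g"
      by (auto simp: free_algebra_def r_distr finsum_addf Pi_def)
  qed
qed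

lemma (in ring) free_gen_closed: "x \<in> X \<Longrightarrow> free_gen R x \<in> carrier (free_algebra R X)"
  by (auto simp: free_gen_def free_algebra_def)

lemma (in ring) grassmann_relations_closed:
  "grassmann_relations R m \<subseteq> carrier (free_algebra R {1..m})"
proof -
  interpret F: ring "free_algebra R {1..m}" by (rule ring_free_algebra)
  show ?thesis
    by (auto simp: grassmann_relations_def Let_def simp del: One_nat_def
        intro!: F.m_closed F.a_closed free_gen_closed)
qed

lemma (in ring) ring_grassmann_algebra: "ring (grassmann_algebra R m)"
proof -
  interpret F: ring "free_algebra R {1..m}" by (rule ring_free_algebra)
  show ?thesis
    unfolding grassmann_algebra_def
    by (intro ideal.quotient_is_ring F.genideal_ideal grassmann_relations_closed)
qed

lemma (in ring) ring_matrix_ring: "ring (matrix_ring n R)" (is "ring ?M")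
proof -
  let ?I = "{1..n}"
  have carI: "A \<in> carrier ?M"
    if "A \<in> extensional (?I \<times> ?I)" "\<And>i j. i \<in> ?I \<Longrightarrow> j \<in> ?I \<Longrightarrow> A (i, j) \<in> carrier R" for A
    using that by (auto simp: matrix_ring_def PiE_def)
  have mem: "A (i, j) \<in> carrier R" if "A \<in> carrier ?M" "i \<in> ?I" "j \<in> ?I" for A i j
    using that by (auto simp: matrix_ring_def)
  have eqI: "A = B"
    if "A \<in> carrier ?M" "B \<in> carrier ?M" "\<And>i j. i \<in> ?I \<Longrightarrow> j \<in> ?I \<Longrightarrow> A (i, j) = B (i, j)" for A B
  proof (rule PiE_ext)
    show "A \<in> ?I \<times> ?I \<rightarrow>\<^sub>E carrier R" "B \<in> ?I \<times> ?I \<rightarrow>\<^sub>E carrier R"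
      using that by (auto simp: matrix_ring_def)
  qed (use that in auto)
  have add: "(A \<oplus>\<^bsub>?M\<^esub> B) (i, j) = A (i, j) \<oplus> B (i, j)" if "i \<in> ?I" "j \<in> ?I" for A B i j
    using that by (simp add: matrix_ring_def)
  have mult: "(A \<otimes>\<^bsub>?M\<^esub> B) (i, j) = (\<Oplus>l\<in>?I. A (i, l) \<otimes> B (l, j))"
    if "i \<in> ?I" "j \<in> ?I" for A B i j
    using that by (simp add: matrix_ring_def)
  have zero: "\<zero>\<^bsub>?M\<^esub> (i, j) = \<zero>" and one: "\<one>\<^bsub>?M\<^esub> (i, j) = (if i = j then \<one> else \<zero>)"
    if "i \<in> ?I" "j \<in> ?I" for i j
    using that by (simp_all add: matrix_ring_def)
  have ext: "A \<oplus>\<^bsub>?M\<^esub> B \<in> extensional (?I \<times> ?I)" "A \<otimes>\<^bsub>?M\<^esub> B \<in> extensional (?I \<times> ?I)"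
    "\<zero>\<^bsub>?M\<^esub> \<in> extensional (?I \<times> ?I)" "\<one>\<^bsub>?M\<^esub> \<in> extensional (?I \<times> ?I)" for A B
    by (simp_all add: matrix_ring_def)
  have add_cl: "A \<oplus>\<^bsub>?M\<^esub> B \<in> carrier ?M" if "A \<in> carrier ?M" "B \<in> carrier ?M" for A B
    by (intro carI ext) (use that in \<open>simp add: add mem del: atLeastAtMost_iff\<close>)
  have mult_cl: "A \<otimes>\<^bsub>?M\<^esub> B \<in> carrier ?M" if "A \<in> carrier ?M" "B \<in> carrier ?M" for A B
    by (intro carI ext)
      (use that in \<open>simp add: mult mem Pi_def del: atLeastAtMost_iff\<close>)
  have zero_cl: "\<zero>\<^bsub>?M\<^esub> \<in> carrier ?M" and one_cl: "\<one>\<^bsub>?M\<^esub> \<in> carrier ?M"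
    by (intro carI ext; simp add: zero one del: atLeastAtMost_iff)+
  note cl = add_cl mult_cl zero_cl one_cl
  show ?thesis
  proof (rule ringI)
    show "abelian_group ?M"
    proof (rule abelian_groupI)
      fix A assume A: "A \<in> carrier ?M"
      let ?N = "\<lambda>(i, j)\<in>?I \<times> ?I. \<ominus> A (i, j)"
      have N: "?N \<in> carrier ?M"
        by (rule carI) (use A mem in auto)
      moreover have "?N \<oplus>\<^bsub>?M\<^esub> A = \<zero>\<^bsub>?M\<^esub>"
        by (rule eqI) (use A N in \<open>simp_all add: cl add zero mem l_neg del: atLeastAtMost_iff\<close>)
      ultimately show "\<exists>B\<in>carrier ?M. B \<oplus>\<^bsub>?M\<^esub> A = \<zero>\<^bsub>?M\<^esub>" by blast
      show "\<zero>\<^bsub>?M\<^esub> \<oplus>\<^bsub>?M\<^esub> A = A"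
        by (rule eqI) (use A in \<open>simp_all add: cl add zero mem del: atLeastAtMost_iff\<close>)
    next
      fix A B assume AB: "A \<in> carrier ?M" "B \<in> carrier ?M"
      show "A \<oplus>\<^bsub>?M\<^esub> B = B \<oplus>\<^bsub>?M\<^esub> A"
        by (rule eqI) (use AB in \<open>simp_all add: cl add mem a_comm del: atLeastAtMost_iff\<close>)
      fix C assume C: "C \<in> carrier ?M"
      show "A \<oplus>\<^bsub>?M\<^esub> B \<oplus>\<^bsub>?M\<^esub> C = A \<oplus>\<^bsub>?M\<^esub> (B \<oplus>\<^bsub>?M\<^esub> C)"
        by (rule eqI) (use AB C in \<open>simp_all add: cl add mem a_assoc del: atLeastAtMost_iff\<close>)
    qed (simp_all add: cl)
    show "monoid ?M"
    proof (rule monoidI)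
      fix A assume A: "A \<in> carrier ?M"
      show "\<one>\<^bsub>?M\<^esub> \<otimes>\<^bsub>?M\<^esub> A = A"
      proof (rule eqI)
        fix i j assume ij: "i \<in> ?I" "j \<in> ?I"
        have "(\<one>\<^bsub>?M\<^esub> \<otimes>\<^bsub>?M\<^esub> A) (i, j) = (\<Oplus>l\<in>?I. if i = l then A (l, j) else \<zero>)"
          unfolding mult[OF ij]
          by (rule finsum_cong') (use A ij in \<open>auto simp: one mem\<close>)
        also have "\<dots> = A (i, j)"
          by (rule finsum_singleton) (use A ij mem in auto)
        finally show "(\<one>\<^bsub>?M\<^esub> \<otimes>\<^bsub>?M\<^esub> A) (i, j) = A (i, j)" .
      qed (use A cl in auto)
      show "A \<otimes>\<^bsub>?M\<^esub> \<one>\<^bsub>?M\<^esub> = A"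
      proof (rule eqI)
        fix i j assume ij: "i \<in> ?I" "j \<in> ?I"
        have "(A \<otimes>\<^bsub>?M\<^esub> \<one>\<^bsub>?M\<^esub>) (i, j) = (\<Oplus>l\<in>?I. if j = l then A (i, l) else \<zero>)"
          unfolding mult[OF ij]
          by (rule finsum_cong') (use A ij in \<open>auto simp: one mem\<close>)
        also have "\<dots> = A (i, j)"
          by (rule finsum_singleton) (use A ij mem in auto)
        finally show "(A \<otimes>\<^bsub>?M\<^esub> \<one>\<^bsub>?M\<^esub>) (i, j) = A (i, j)" .
      qed (use A cl in auto)
    next
      fix A B C assume ABC: "A \<in> carrier ?M" "B \<in> carrier ?M" "C \<in> carrier ?M"
      show "A \<otimes>\<^bsub>?M\<^esub> B \<otimes>\<^bsub>?M\<^esub> C = A \<otimes>\<^bsub>?M\<^esub> (B \<otimes>\<^bsub>?M\<^esub> C)"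
      proof (rule eqI)
        fix i j assume ij: "i \<in> ?I" "j \<in> ?I"
        have "(A \<otimes>\<^bsub>?M\<^esub> B \<otimes>\<^bsub>?M\<^esub> C) (i, j)
            = (\<Oplus>l\<in>?I. \<Oplus>r\<in>?I. A (i, r) \<otimes> B (r, l) \<otimes> C (l, j))"
          unfolding mult[OF ij]
          by (rule finsum_cong')
            (use ABC ij in \<open>simp_all add: mult finsum_ldistr mem Pi_def del: atLeastAtMost_iff\<close>)
        also have "\<dots> = (\<Oplus>r\<in>?I. \<Oplus>l\<in>?I. A (i, r) \<otimes> B (r, l) \<otimes> C (l, j))"
          by (rule finsum_commute)
            (use ABC ij in \<open>simp_all add: mem del: atLeastAtMost_iff\<close>)
        also have "\<dots> = (A \<otimes>\<^bsub>?M\<^esub> (B \<otimes>\<^bsub>?M\<^esub> C)) (i, j)"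
          unfolding mult[OF ij]
          by (rule finsum_cong')
            (use ABC ij in \<open>simp_all add: mult finsum_rdistr mem Pi_def m_assoc
                del: atLeastAtMost_iff cong: finsum_cong\<close>)
        finally show "(A \<otimes>\<^bsub>?M\<^esub> B \<otimes>\<^bsub>?M\<^esub> C) (i, j) = (A \<otimes>\<^bsub>?M\<^esub> (B \<otimes>\<^bsub>?M\<^esub> C)) (i, j)" .
      qed (use ABC cl in auto)
    qed (simp_all add: cl)
  next
    fix A B C assume ABC: "A \<in> carrier ?M" "B \<in> carrier ?M" "C \<in> carrier ?M"
    show "(A \<oplus>\<^bsub>?M\<^esub> B) \<otimes>\<^bsub>?M\<^esub> C = A \<otimes>\<^bsub>?M\<^esub> C \<oplus>\<^bsub>?M\<^esub> B \<otimes>\<^bsub>?M\<^esub> C"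
      by (rule eqI) (use ABC in \<open>simp_all add: cl add mult mem l_distr finsum_addf Pi_def
          del: atLeastAtMost_iff cong: finsum_cong\<close>)
    show "C \<otimes>\<^bsub>?M\<^esub> (A \<oplus>\<^bsub>?M\<^esub> B) = C \<otimes>\<^bsub>?M\<^esub> A \<oplus>\<^bsub>?M\<^esub> C \<otimes>\<^bsub>?M\<^esub> B"
      by (rule eqI) (use ABC in \<open>simp_all add: cl add mult mem r_distr finsum_addf Pi_def
          del: atLeastAtMost_iff cong: finsum_cong\<close>)
  qed
qed

end

theory Submission
  imports Defs "HOL-Combinatorics.Multiset_Permutations"
begin

text \<open>
  By multilinearity it suffices to evaluate the standard polynomial at \<open>x\<^sub>s = c\<^sub>s B\<^sub>s\<close>, where \<open>c\<^sub>s\<close> is a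
  monomial in the generators and \<open>B\<^sub>s\<close> is the identity matrix or a matrix unit other than \<open>E\<^sub>1\<^sub>1\<close>.
  Reordering the scalars gives the product of all \<open>c\<^sub>s\<close> times an integer matrix: the sum over all
  orderings of the \<open>B\<^sub>s\<close>, alternating except that two factors with odd scalars commute. If more than
  \<open>m\<close> scalars are odd, their product is zero. Otherwise the integer matrix is zero if two even
  factors coincide, or if the identity is an even factor (the degree being even). Counting leaves
  one case: \<open>n\<close> is even, \<open>m\<close> is odd, exactly \<open>m\<close> scalars are odd, and the even factors are the
  \<open>n\<^sup>2 - 1\<close> basis matrices other than the identity, once each. Then declare one even factor \<open>B\<close> odd
  and take the alternating sum over all ways of declaring one of the \<open>m + 1\<close> odd factors even. As
  \<open>m + 1\<close> is even this sum is zero, whereas its nonzero terms all equal the wanted matrix, one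
  for each odd copy of \<open>B\<close>; so a positive multiple of an integer matrix vanishes.
\<close>

section \<open>Super-alternating sums of words\<close>

text \<open>
  A letter is a pair of its parity (\<open>True\<close> is odd) and a label. Even letters carry even, hence
  central, scalars; odd letters carry anticommuting scalars, which turn the alternating sum over
  the orderings into one that is symmetric in the odd letters.
\<close>

definition super_sign :: "bool \<times> 'l \<Rightarrow> bool \<times> 'l \<Rightarrow> int" where
  "super_sign x y = (if fst x \<and> fst y then 1 else - 1)"

text \<open>The signed sum over all positions for \<open>x\<close>, each letter passed on the way
  contributing its \<open>super_sign\<close>. Words occur only as arguments of a functional
  \<open>f\<close>, so linearity in \<open>f\<close> replaces formal linear combinations of
  words.\<close>

fun signed_insert :: "bool \<times> 'l \<Rightarrow> ((bool \<times> 'l) list \<Rightarrow> int) \<Rightarrow> (bool \<times> 'l) list \<Rightarrow> int" where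
  "signed_insert x f [] = f [x]"
| "signed_insert x f (y # w) = f (x # y # w) + super_sign x y * signed_insert x (\<lambda>u. f (y # u)) w"

text \<open>Unfolding inserts the last letter of the list first and its head last. The outcome is
  the signed sum over all orderings, with equal letters at different positions counted
  separately.\<close>

fun super_alt :: "(bool \<times> 'l) list \<Rightarrow> ((bool \<times> 'l) list \<Rightarrow> int) \<Rightarrow> int" where
  "super_alt [] f = f []"
| "super_alt (x # xs) f = super_alt xs (signed_insert x f)"

section \<open>Linearity and supersymmetry of the alternating sums\<close>

lemma super_sign_square [simp]: "super_sign x y * super_sign x y = 1"
  "super_sign x y * (super_sign x y * a) = a"
  by (simp_all add: super_sign_def)

lemma super_sign_commute: "super_sign x y = super_sign y x"
  by (auto simp: super_sign_def)

lemma signed_insert_add: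
  "signed_insert x (\<lambda>u. f u + g u) w = signed_insert x f w + signed_insert x g w"
  by (induction w arbitrary: f g) (simp_all add: algebra_simps)

lemma signed_insert_mult: "signed_insert x (\<lambda>u. c * f u) w = c * signed_insert x f w"
  by (induction w arbitrary: f) (simp_all add: algebra_simps)

lemma signed_insert_diff:
  "signed_insert x (\<lambda>u. f u - g u) w = signed_insert x f w - signed_insert x g w"
  by (induction w arbitrary: f g) (simp_all add: right_diff_distrib)

lemma super_alt_add: "super_alt xs (\<lambda>u. f u + g u) = super_alt xs f + super_alt xs g"
  by (induction xs arbitrary: f g) (simp_all add: signed_insert_add[abs_def])

lemma super_alt_diff: "super_alt xs (\<lambda>u. f u - g u) = super_alt xs f - super_alt xs g"
  by (induction xs arbitrary: f g) (simp_all add: signed_insert_diff[abs_def])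

lemma super_alt_mult: "super_alt xs (\<lambda>u. c * f u) = c * super_alt xs f"
  by (induction xs arbitrary: f) (simp_all add: signed_insert_mult[abs_def])

lemma signed_insert_eq_0:
  "(\<And>u. mset u = add_mset x (mset w) \<Longrightarrow> f u = 0) \<Longrightarrow> signed_insert x f w = 0"
proof (induction w arbitrary: f)
  case (Cons y w)
  have "signed_insert x (\<lambda>u. f (y # u)) w = 0"
    by (rule Cons.IH) (simp add: Cons.prems)
  then show ?case by (simp add: Cons.prems)
qed simp

lemma super_alt_eq_0:
  "(\<And>u. mset u = mset xs \<Longrightarrow> f u = 0) \<Longrightarrow> super_alt xs f = 0"
proof (induction xs arbitrary: f)
  case (Cons x xs)
  have "super_alt xs (signed_insert x f) = 0"
    by (rule Cons.IH) (auto intro!: signed_insert_eq_0 Cons.prems)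
  then show ?case by simp
qed simp

text \<open>Both sides run over the same words. They differ only in which relative order of
  \<open>x\<close> and \<open>y\<close> counts as unswapped, and this costs one
  \<open>super_sign\<close>.\<close>

lemma signed_insert_swap:
  "signed_insert y (signed_insert x f) w = super_sign x y * signed_insert x (signed_insert y f) w"
proof (induction w arbitrary: f)
  case Nil
  show ?case by (simp add: algebra_simps super_sign_commute[of y x])
next
  case (Cons z w)
  note s = super_sign_commute[of y x]
  show ?case
    using Cons.IH[of "\<lambda>v. f (z # v)"]
    by (simp add: signed_insert_add signed_insert_mult algebra_simps s)
qed

lemma super_alt_swap: "super_alt (x # y # zs) f = super_sign x y * super_alt (y # x # zs) f"
proof -
  have e: "signed_insert y (signed_insert x f) =
      (\<lambda>w. super_sign x y * signed_insert x (signed_insert y f) w)"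
    by (rule ext) (rule signed_insert_swap)
  show ?thesis by (simp add: e super_alt_mult)
qed

lemma super_alt_move:
  "super_alt (xs @ y # zs) f = (\<Prod>x\<leftarrow>xs. super_sign x y) * super_alt (y # xs @ zs) f"
proof (induction xs arbitrary: f)
  case (Cons x xs)
  have "super_alt (x # xs @ y # zs) f
      = (\<Prod>x\<leftarrow>xs. super_sign x y) * super_alt (y # xs @ zs) (signed_insert x f)"
    using Cons.IH[of "signed_insert x f"] by simp
  also have "super_alt (y # xs @ zs) (signed_insert x f) = super_alt (x # y # xs @ zs) f"
    by simp
  also have "\<dots> = super_sign x y * super_alt (y # x # xs @ zs) f" by (rule super_alt_swap)
  finally show ?case by (simp add: mult_ac)
qed simp

text \<open>Reordering the list changes the sum only by factors 1 or -1, so vanishing depends on the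
  multiset of letters alone.\<close>

lemma super_alt_eq_0_mset:
  assumes "mset xs = mset ys" "super_alt ys f = 0"
  shows "super_alt xs f = 0"
  using assms
proof (induction xs arbitrary: ys f)
  case (Cons x xs)
  from Cons.prems(1) have "x \<in> set ys" by (metis list.set_intros(1) set_mset_mset)
  then obtain us vs where ys: "ys = us @ x # vs" by (metis split_list)
  have "prod_list (map (\<lambda>y. super_sign y x) us) \<noteq> 0"
    by (auto simp: prod_list_zero_iff super_sign_def)
  with Cons.prems(2) have "super_alt (us @ vs) (signed_insert x f) = 0"
    by (auto simp: ys super_alt_move)
  then show ?case
    using Cons.IH[of "us @ vs"] Cons.prems(1) by (simp add: ys)
qed simp

text \<open>Two equal even letters, brought to the front, can be exchanged at the price of a sign,
  so the integer sum equals its own negative.\<close>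

lemma super_alt_duplicate:
  assumes "xs ! i = (False, l)" "xs ! j = (False, l)" "i \<noteq> j" "i < length xs" "j < length xs"
  shows "super_alt xs f = 0"
proof -
  obtain us vs where xs: "xs = us @ (False, l) # vs" and us: "length us = i"
    using id_take_nth_drop[of i xs] assms by fastforce
  have "(us @ vs) ! (if j < i then j else j - 1) = (False, l)"
    "(if j < i then j else j - 1) < length (us @ vs)"
    using assms us by (auto simp: xs nth_append nth_Cons' split: if_splits)
  then have "(False, l) \<in> set (us @ vs)" by (metis nth_mem)
  then obtain us' vs' where e: "us @ vs = us' @ (False, l) # vs'" by (metis split_list)
  have "mset xs = add_mset (False, l) (mset (us @ vs))" by (simp add: xs)
  then have *: "mset xs = mset ((False, l) # (False, l) # us' @ vs')"
    unfolding e by simp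
  have "super_alt ((False, l) # (False, l) # us' @ vs') f = 0"
    using super_alt_swap[of "(False, l)" "(False, l)" "us' @ vs'" f]
    by (simp add: super_sign_def del: super_alt.simps)
  with * show ?thesis by (rule super_alt_eq_0_mset)
qed

text \<open>An even letter changes sign at every letter it passes, whatever the parity of that
  letter. If \<open>f\<close> does not see it, the \<open>length w + 1\<close> insertions contribute
  \<open>g w\<close> with alternating signs.\<close>

lemma signed_insert_neutral:
  assumes "\<And>us vs. f (us @ (False, l) # vs) = g (us @ vs)"
  shows "signed_insert (False, l) f w = (if even (length w) then g w else 0)"
  using assms
proof (induction w arbitrary: f g)
  case Nil
  show ?case using Nil[of "[]" "[]"] by simp
next
  case (Cons y w)
  have "signed_insert (False, l) (\<lambda>u. f (y # u)) w = (if even (length w) then g (y # w) else 0)"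
    by (rule Cons.IH[where g = "\<lambda>u. g (y # u)"]) (use Cons.prems[of "y # _"] in simp)
  moreover have "f ((False, l) # y # w) = g (y # w)" using Cons.prems[of "[]"] by simp
  ultimately show ?case by (simp add: super_sign_def)
qed

lemma super_alt_neutral:
  assumes "\<And>us vs. f (us @ (False, l) # vs) = g (us @ vs)"
    and "(False, l) \<in> set xs" "even (length xs)"
  shows "super_alt xs f = 0"
proof -
  obtain us vs where xs: "xs = us @ (False, l) # vs" using assms(2) by (metis split_list)
  \<comment> \<open>With the neutral letter at the head of the list, its insertion acts on words of
    odd length, where the alternating signs cancel in pairs.\<close>
  have "super_alt (us @ vs) (signed_insert (False, l) f) = 0"
  proof (rule super_alt_eq_0)
    fix w assume "mset w = mset (us @ vs)"
    then have "length w = length (us @ vs)" by (rule mset_eq_length)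
    then have "odd (length w)" using assms(3) by (simp add: xs)
    then show "signed_insert (False, l) f w = 0"
      using signed_insert_neutral[of f l g w] assms(1) by simp
  qed
  then show ?thesis
    by (intro super_alt_eq_0_mset[of xs "(False, l) # us @ vs"]) (simp_all add: xs)
qed

text \<open>
  The odd derivation that makes one odd letter even. On a function of the labels alone it is an
  alternating sum over the odd letters, so it vanishes on words with an even number of them; moved
  through \<open>super_alt\<close>, this becomes a linear relation between values of \<open>super_alt\<close>.
\<close>

fun flip_deriv :: "((bool \<times> 'l) list \<Rightarrow> int) \<Rightarrow> (bool \<times> 'l) list \<Rightarrow> int" where
  "flip_deriv f [] = 0"
| "flip_deriv f (y # w) = (if fst y
     then f ((False, snd y) # w) - flip_deriv (\<lambda>u. f (y # u)) w
     else flip_deriv (\<lambda>u. f (y # u)) w)"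

lemma flip_deriv_add: "flip_deriv (\<lambda>u. f u + g u) w = flip_deriv f w + flip_deriv g w"
  by (induction w arbitrary: f g) simp_all

lemma flip_deriv_diff: "flip_deriv (\<lambda>u. f u - g u) w = flip_deriv f w - flip_deriv g w"
  by (induction w arbitrary: f g) simp_all

text \<open>Every flip leaves the value \<open>f w\<close> unchanged and the signs alternate along
  the odd letters, so only the parity of their number matters.\<close>

lemma flip_deriv_parity_blind:
  assumes "\<And>u. f u = g (map snd u)"
  shows "flip_deriv f w = (if odd (length (filter fst w)) then f w else 0)"
  using assms
proof (induction w arbitrary: f g)
  case (Cons y w)
  have "flip_deriv (\<lambda>u. f (y # u)) w = (if odd (length (filter fst w)) then f (y # w) else 0)"
    by (rule Cons.IH[where g = "\<lambda>u. g (snd y # u)"]) (simp add: Cons.prems)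
  moreover have "f ((False, snd y) # w) = f (y # w)" by (simp add: Cons.prems)
  ultimately show ?case by simp
qed simp

text \<open>A Leibniz rule. If the inserted letter is flipped, the derivation sign for each odd
  letter before it and the insertion sign for each even one combine to the insertion sign of an even
  letter. If an odd letter \<open>y\<close> of \<open>w\<close> is flipped, the two orders of
  operation differ by one sign: the derivation passes the inserted letter, or the inserted letter
  passes \<open>y\<close> with a different parity.\<close>

lemma signed_insert_flip_deriv_odd:
  "signed_insert (True, l) (flip_deriv f) w =
     signed_insert (False, l) f w - flip_deriv (signed_insert (True, l) f) w"
proof (induction w arbitrary: f)
  case (Cons y w)
  show ?case
    using Cons.IH[of "\<lambda>u. f (y # u)"]
    by (simp add: super_sign_def signed_insert_diff flip_deriv_add flip_deriv_diff)
qed simp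

text \<open>The derivation neither counts nor flips an even letter, and the insertion sign of an
  even letter ignores the parity of the letters it passes.\<close>

lemma signed_insert_flip_deriv_even:
  "signed_insert (False, l) (flip_deriv f) w = flip_deriv (signed_insert (False, l) f) w"
proof (induction w arbitrary: f)
  case (Cons y w)
  show ?case
    using Cons.IH[of "\<lambda>u. f (y # u)"]
    by (simp add: super_sign_def signed_insert_diff flip_deriv_add flip_deriv_diff)
qed simp

text \<open>The two Leibniz rules iterated over the list: each odd letter before position
  \<open>i\<close> contributes a sign, and nothing remains on the empty word.\<close>

lemma super_alt_flip_deriv:
  "super_alt xs (flip_deriv f) = (\<Sum>i<length xs. if fst (xs ! i)
     then (- 1) ^ length (filter fst (take i xs)) * super_alt (xs[i := (False, snd (xs ! i))]) f
     else 0)"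
proof (induction xs arbitrary: f)
  case (Cons x xs)
  show ?case
  proof (cases "fst x")
    case True
    then have x: "x = (True, snd x)" by (simp add: prod_eq_iff)
    have e: "signed_insert x (flip_deriv f) =
        (\<lambda>w. signed_insert (False, snd x) f w - flip_deriv (signed_insert x f) w)"
      by (rule ext) (subst (1 3) x, rule signed_insert_flip_deriv_odd)
    show ?thesis
      unfolding length_Cons sum.lessThan_Suc_shift
      by (simp add: True e super_alt_diff Cons.IH o_def flip: sum_negf)
        (intro sum.cong, use True in auto)
  next
    case False
    then have x: "x = (False, snd x)" by (simp add: prod_eq_iff)
    have e: "signed_insert x (flip_deriv f) = flip_deriv (signed_insert x f)"
      by (rule ext) (subst (1 2) x, rule signed_insert_flip_deriv_even)
    show ?thesis
      unfolding length_Cons sum.lessThan_Suc_shift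
      by (simp add: False e Cons.IH)
        (intro sum.cong, use False in auto)
  qed
qed simp


text \<open>Even letters with distinct labels other than \<open>unit_label\<close> number at most
  \<open>card L - 1\<close>. Hence \<open>len\<close> leaves only one set of even labels for which
  no neutral or repeated even letter forces vanishing; there \<open>crit\<close> makes the number of
  odd letters odd, and the derivation applies.\<close>

lemma super_alt_vanish:
  assumes f: "\<And>u. f u = g (map snd u)"
    and g: "\<And>us vs. g (us @ unit_label # vs) = g (us @ vs)"
    and L: "finite L" "unit_label \<in> L" "snd ` set xs \<subseteq> L"
    and len: "even (length xs)" "card L \<le> Suc (length (filter (Not \<circ> fst) xs))"
    and crit: "card L = Suc (length (filter (Not \<circ> fst) xs)) \<Longrightarrow> odd (length (filter fst xs))"
  shows "super_alt xs f = 0"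
proof -
  define E where "E = filter (Not \<circ> fst) xs"
  define Q where "Q = filter fst xs"
  have mEO: "mset xs = mset (E @ Q)"
    unfolding E_def Q_def by (induction xs) auto
  have E: "x = (False, snd x)" if "x \<in> set E" for x using that by (auto simp: E_def prod_eq_iff)
  have Q: "x = (True, snd x)" if "x \<in> set Q" for x using that by (auto simp: Q_def prod_eq_iff)
  have EL: "snd ` set E \<subseteq> L" and OL: "snd ` set Q \<subseteq> L" using L(3) by (auto simp: E_def Q_def)
  have f': "f (us @ (False, unit_label) # vs) = f (us @ vs)" for us vs by (simp add: f g)
  have vanish_neutral: "super_alt ys f = 0" if "(False, unit_label) \<in> set ys" "even (length ys)" for ys
    using f' that by (rule super_alt_neutral)
  consider (neutral) "unit_label \<in> snd ` set E" | (duplicate) "\<not> distinct (map snd E)"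
    | (critical) "unit_label \<notin> snd ` set E" "distinct (map snd E)" by blast
  then show ?thesis
  proof cases
    case neutral
    then have "(False, unit_label) \<in> set E" using E by force
    then show ?thesis using len by (intro vanish_neutral) (auto simp: E_def)
  next
    case duplicate
    then obtain i j where ij: "i < length E" "j < length E" "i \<noteq> j" "snd (E ! i) = snd (E ! j)"
      by (auto simp: distinct_conv_nth)
    have "super_alt (E @ Q) f = 0"
      by (rule super_alt_duplicate[of _ i "snd (E ! i)" j])
        (use ij E[of "E ! i"] E[of "E ! j"] in \<open>auto simp: nth_append\<close>)
    with mEO show ?thesis by (rule super_alt_eq_0_mset)
  next
    case critical
    have cE: "card (snd ` set E) = length E"
      using critical(2) distinct_card by fastforce
    have sub: "snd ` set E \<subseteq> L - {unit_label}" using EL critical(1) by auto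
    have "card (L - {unit_label}) \<le> card (snd ` set E)"
      using len(2) L cE by (simp add: E_def)
    then have all: "snd ` set E = L - {unit_label}"
      by (intro card_seteq) (use sub L in auto)
    have "card L = Suc (length E)" using all cE L by (metis card_Suc_Diff1)
    then have oddO: "odd (length Q)" using crit by (simp add: E_def Q_def)
    have "length xs = length E + length Q" using mEO by (metis length_append size_mset)
    \<comment> \<open>An even total with an odd number of odd letters leaves an odd number of even
      ones, so there is an even letter to turn odd.\<close>
    with len(1) oddO have "E \<noteq> []" by auto
    then obtain a E' where EE: "E = (False, a) # E'"
      using E by (metis list.exhaust list.set_intros(1))
    \<comment> \<open>The odd letters are split by whether they already carry the label
      \<open>a\<close>; \<open>b\<close> may be zero.\<close>
    define b where "b = length (filter (\<lambda>x. snd x = a) Q)"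
    define Q' where "Q' = filter (\<lambda>x. snd x \<noteq> a) Q"
    define rest where "rest = Q' @ E'"
    have "filter (\<lambda>x. snd x = a) Q = replicate b (True, a)"
      unfolding b_def using Q by (intro replicate_eqI) auto
    moreover have "mset Q = mset (filter (\<lambda>x. snd x = a) Q) + mset Q'"
      unfolding Q'_def by (induction Q) auto
    ultimately have mQ: "mset Q = mset (replicate b (True, a)) + mset Q'" by simp
    have lQ: "length Q = b + length Q'"
      using arg_cong[OF mQ, of size] by simp
    \<comment> \<open>Make \<open>a\<close> odd and apply the derivation: turning one of the \<open>b + 1\<close> odd letters with label \<open>a\<close>
      back to even gives \<open>X\<close> each time, and any other choice produces a neutral or a repeated even
      letter. Hence \<open>(b + 1) X = 0\<close>.\<close>
    define X where "X = super_alt ((False, a) # replicate b (True, a) @ rest) f"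
    define ys where "ys = replicate (Suc b) (True, a) @ rest"
    have mys: "mset ((False, a) # replicate b (True, a) @ rest) = mset xs"
      unfolding mEO EE rest_def using mQ by simp
    then have lys: "length ys = length xs"
      using mset_eq_length[OF mys] by (simp add: ys_def)
    \<comment> \<open>\<open>ys\<close> has one odd letter more than \<open>xs\<close>, hence an
      even number of them, and the derivation of the parity-blind \<open>f\<close> is zero on every
      rearrangement.\<close>
    have "super_alt ys (flip_deriv f) = 0"
    proof (rule super_alt_eq_0)
      fix u assume "mset u = mset ys"
      then have "mset (filter fst u) = mset (filter fst ys)" by simp
      then have "length (filter fst u) = length (filter fst ys)" by (rule mset_eq_length)
      moreover have "filter fst Q' = Q'"
        by (rule filter_True) (auto simp: Q'_def Q_def)
      moreover have "filter fst E' = []"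
        using E EE by (force simp: filter_empty_conv)
      ultimately have "length (filter fst u) = Suc (length Q)"
        by (simp add: ys_def rest_def lQ)
      then show "flip_deriv f u = 0"
        using oddO flip_deriv_parity_blind[of f g u] f by simp
    qed
    moreover have "super_alt ys (flip_deriv f) = (\<Sum>i<length ys. if i < Suc b then X else 0)"
      unfolding super_alt_flip_deriv
    proof (intro sum.cong refl)
      fix i assume "i \<in> {..<length ys}"
      then have i: "i < length ys" by simp
      let ?t = "if fst (ys ! i)
        then (- 1) ^ length (filter fst (take i ys)) * super_alt (ys[i := (False, snd (ys ! i))]) f
        else 0"
      show "?t = (if i < Suc b then X else 0)"
      proof (cases "i < Suc b")
        case True
        then have "Suc b = i + Suc (b - i)" by simp
        then have ys: "ys = replicate i (True, a) @ (True, a) # replicate (b - i) (True, a) @ rest"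
          unfolding ys_def by (metis append_Cons append_assoc replicate_Suc replicate_add)
        have "replicate i (True, a) @ replicate (b - i) (True, a) = replicate b (True, a)"
          using True by (simp flip: replicate_add)
        \<comment> \<open>The flipped letter moves to the front past \<open>i\<close> odd letters,
          which costs \<open>(- 1) ^ i\<close>. The derivation carries the same sign, so the two
          cancel.\<close>
        then have "super_alt (ys[i := (False, a)]) f = (- 1) ^ i * X"
          unfolding ys X_def
          by (simp add: list_update_append super_alt_move super_sign_def
              del: super_alt.simps flip: append_assoc)
        moreover have "ys ! i = (True, a)" "length (filter fst (take i ys)) = i"
          by (simp_all add: ys nth_append)
        ultimately show ?thesis using True by (simp flip: power_add mult_2)
      next
        case False
        have "super_alt (ys[i := (False, snd (ys ! i))]) f = 0" if o: "fst (ys ! i)"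
        proof -
          have "ys ! i \<in> set rest"
            using False i by (auto simp: ys_def nth_append)
          with o have "ys ! i \<in> set Q'"
            using E[of "ys ! i"] EE by (auto simp: rest_def prod_eq_iff)
          then have l: "snd (ys ! i) \<in> L" "snd (ys ! i) \<noteq> a"
            using OL by (auto simp: Q'_def)
          show ?thesis
          proof (cases "snd (ys ! i) = unit_label")
            case True
            then show ?thesis
              using i len(1) lys by (intro vanish_neutral) (auto simp: set_update_memI)
          next
            case False
            then have "snd (ys ! i) \<in> snd ` set E" using l(1) all by simp
            then have "(False, snd (ys ! i)) \<in> set E'" using E EE l(2) by force
            then have "(False, snd (ys ! i)) \<in> set ys" by (simp add: ys_def rest_def)
            then obtain j where j: "j < length ys" "ys ! j = (False, snd (ys ! i))"
              by (metis in_set_conv_nth)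
            then have "j \<noteq> i" using o by (metis fst_conv)
            then show ?thesis
              using i j by (intro super_alt_duplicate[of _ i "snd (ys ! i)" j]) auto
          qed
        qed
        then show ?thesis using False by simp
      qed
    qed
    moreover have "(\<Sum>i<length ys. if i < Suc b then X else 0) = int (Suc b) * X"
    proof -
      have "(\<Sum>i<length ys. if i < Suc b then X else 0) = (\<Sum>i<Suc b. X)"
        by (rule sum.mono_neutral_cong_right) (auto simp: ys_def)
      then show ?thesis by simp
    qed
    \<comment> \<open>\<open>X\<close> is an integer, so the positive factor \<open>b + 1\<close>
      cancels whatever the torsion of the coefficient ring.\<close>
    ultimately have "X = 0" by simp
    then show ?thesis unfolding X_def by (intro super_alt_eq_0_mset[OF mys[symmetric]])
  qed
qed

section \<open>Sums over permutations\<close>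

text \<open>A product over the inversions of a word without repetition. The constant -1 gives the
  sign of a permutation; other choices of \<open>c\<close> give the sign from reordering scalars and
  the sign in \<open>super_alt\<close>.\<close>

fun inversion_prod :: "(nat \<Rightarrow> nat \<Rightarrow> int) \<Rightarrow> nat list \<Rightarrow> int" where
  "inversion_prod c [] = 1"
| "inversion_prod c (y # w) = (\<Prod>z\<in>{z\<in>set w. z < y}. c y z) * inversion_prod c w"

lemma inversion_prod_mult:
  "inversion_prod (\<lambda>i j. c i j * d i j) w = inversion_prod c w * inversion_prod d w"
  by (induction w) (simp_all add: prod.distrib mult_ac)

text \<open>\<open>super_alt\<close> grows by insertion, whereas permutations are enumerated by
  their first entry; this expansion links the two. Bringing the letter at \<open>y\<close> to the
  front passes exactly the letters of smaller index.\<close>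

lemma super_alt_expand_first:
  assumes "sorted_wrt (<) (l :: nat list)" "l \<noteq> []"
  shows "super_alt (map x l) f =
    (\<Sum>y\<in>set l. (\<Prod>z\<in>{z\<in>set l. z < y}. super_sign (x y) (x z)) *
       super_alt (map x (remove1 y l)) (\<lambda>u. f (x y # u)))"
  using assms
proof (induction l arbitrary: f)
  case (Cons a l)
  let ?K = "\<lambda>l y. \<Prod>z\<in>{z\<in>set l. z < y}. super_sign (x y) (x z)"
  let ?F = "\<lambda>l y f. super_alt (map x (remove1 y l)) (\<lambda>u. f (x y # u))"
  have al: "a < y" if "y \<in> set l" for y using Cons.prems that by simp
  have Ka: "?K (a # l) a = 1"
  proof -
    have "{z \<in> set (a # l). z < a} = {}" using al by (auto dest: less_not_sym)
    then show ?thesis by (simp only: prod.empty)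
  qed
  have K: "?K (a # l) y = super_sign (x a) (x y) * ?K l y" if "y \<in> set l" for y
  proof -
    have "{z \<in> set (a # l). z < y} = insert a {z \<in> set l. z < y}" using al[OF that] by auto
    moreover have "a \<notin> {z \<in> set l. z < y}" using al by auto
    ultimately show ?thesis by (simp add: super_sign_commute)
  qed
  have "a \<notin> set l" using al by auto
  then have *: "sum g (set (a # l)) = g a + sum g (set l)" for g :: "nat \<Rightarrow> int" by simp
  have "(\<Sum>y\<in>set (a # l). ?K (a # l) y * ?F (a # l) y f) =
      super_alt (map x l) (\<lambda>u. f (x a # u)) + (\<Sum>y\<in>set l. ?K (a # l) y * ?F (a # l) y f)"
    unfolding * Ka by simp
  also have "\<dots> = super_alt (map x (a # l)) f"
  proof (cases "l = []")
    case False
    have IH: "super_alt (map x l) g = (\<Sum>y\<in>set l. ?K l y * ?F l y g)" for g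
      using Cons.IH False Cons.prems by simp
    have "super_alt (map x (a # l)) f = (\<Sum>y\<in>set l. ?K l y * ?F l y (signed_insert (x a) f))"
      using IH[of "signed_insert (x a) f"] by simp
    \<comment> \<open>The letter \<open>x a\<close> lands either before \<open>x y\<close> or behind
      it. The second case costs \<open>super_sign (x a) (x y)\<close>, which is the additional
      factor in \<open>?K (a # l) y\<close>.\<close>
    also have "\<dots> = (\<Sum>y\<in>set l. ?K l y * ?F l y (\<lambda>u. f (x a # u)) +
        ?K (a # l) y * ?F (a # l) y f)"
    proof (intro sum.cong refl)
      fix y assume y: "y \<in> set l"
      then have "y \<noteq> a" using al by auto
      then show "?K l y * ?F l y (signed_insert (x a) f) =
          ?K l y * ?F l y (\<lambda>u. f (x a # u)) + ?K (a # l) y * ?F (a # l) y f"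
        unfolding K[OF y]
        by (simp add: super_alt_add super_alt_mult algebra_simps)
    qed
    finally show ?thesis by (simp add: sum.distrib IH del: super_alt.simps)
  qed simp
  finally show ?case ..
qed simp

text \<open>The words consist of indices rather than letters, since letters may coincide; the
  inversions of the index word then determine the sign.\<close>

lemma super_alt_eq_sum_permutations:
  assumes "sorted_wrt (<) l"
  shows "super_alt (map x l) f = (\<Sum>w\<in>permutations_of_set (set l).
    inversion_prod (\<lambda>i j. super_sign (x i) (x j)) w * f (map x w))"
  using assms
proof (induction "length l" arbitrary: l f)
  case (Suc n)
  let ?I = "inversion_prod (\<lambda>i j. super_sign (x i) (x j))"
  let ?K = "\<lambda>y. \<Prod>z\<in>{z\<in>set l. z < y}. super_sign (x y) (x z)"
  have ne: "l \<noteq> []" using Suc.hyps(2) by auto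
  have d: "distinct l" using Suc.prems strict_sorted_iff by blast
  have "(\<Sum>w\<in>permutations_of_set (set l). ?I w * f (map x w)) =
    (\<Sum>y\<in>set l. \<Sum>w\<in>(#) y ` permutations_of_set (set l - {y}). ?I w * f (map x w))"
    by (subst permutations_of_set_nonempty, use ne in simp, subst sum.UNION_disjoint) auto
  also have "\<dots> = (\<Sum>y\<in>set l. ?K y * super_alt (map x (remove1 y l)) (\<lambda>u. f (x y # u)))"
  proof (intro sum.cong refl)
    fix y assume y: "y \<in> set l"
    have so: "sorted_wrt (<) (remove1 y l)"
      using d Suc.prems
      by (simp add: distinct_remove1_removeAll removeAll_filter_not_eq sorted_wrt_filter)
    have sr: "set (remove1 y l) = set l - {y}" using d by simp
    have "(\<Sum>w\<in>(#) y ` permutations_of_set (set l - {y}). ?I w * f (map x w)) =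
      (\<Sum>w\<in>permutations_of_set (set l - {y}). ?I (y # w) * f (x y # map x w))"
      by (subst sum.reindex) simp_all
    also have "\<dots> = (\<Sum>w\<in>permutations_of_set (set l - {y}). ?K y * (?I w * f (x y # map x w)))"
    proof (intro sum.cong refl)
      fix w assume "w \<in> permutations_of_set (set l - {y})"
      then have "{z \<in> set w. z < y} = {z \<in> set l. z < y}"
        by (auto dest: permutations_of_setD)
      then show "?I (y # w) * f (x y # map x w) = ?K y * (?I w * f (x y # map x w))"
        by simp
    qed
    also have "\<dots> = ?K y * super_alt (map x (remove1 y l)) (\<lambda>u. f (x y # u))"
      by (subst Suc.hyps(1))
        (use Suc.hyps(2) Suc.prems y in \<open>simp_all add: length_remove1 sr sum_distrib_left so\<close>)
    finally show "(\<Sum>w\<in>(#) y ` permutations_of_set (set l - {y}). ?I w * f (map x w)) =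
      ?K y * super_alt (map x (remove1 y l)) (\<lambda>u. f (x y # u))" .
  qed
  also have "\<dots> = super_alt (map x l) f"
    by (rule super_alt_expand_first[OF Suc.prems ne, symmetric])
  finally show ?case ..
qed simp

section \<open>Signs of permutations as inversion products\<close>

lemma ex_permutes_move_front:
  assumes "distinct (u @ y # v)"
  shows "\<exists>c. c permutes set (u @ y # v) \<and> map c (u @ y # v) = y # u @ v \<and> sign c = (- 1) ^ length u"
  using assms
proof (induction u)
  case Nil
  show ?case by (intro exI[of _ id]) (auto simp: id_def[symmetric] permutes_id)
next
  case (Cons a u)
  then obtain c where c: "c permutes set (u @ y # v)" "map c (u @ y # v) = y # u @ v"
    "sign c = (- 1) ^ length u" by auto
  \<comment> \<open>\<open>c\<close> fixes \<open>a\<close> and yields \<open>a # y # u @ v\<close>.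
    One more transposition exchanges the first two entries and accounts for the additional
    sign.\<close>
  let ?t = "transpose a y"
  have t: "?t permutes set (a # u @ y # v)" by (rule permutes_swap_id) auto
  have c': "c permutes set (a # u @ y # v)" using c(1) by (rule permutes_subset) auto
  have ca: "c a = a" using c(1) Cons.prems by (intro permutes_not_in) auto
  have "map (?t \<circ> c) (a # u @ y # v) = map ?t (a # map c (u @ y # v))" using ca by simp
  also have "\<dots> = y # a # u @ v"
    using Cons.prems unfolding c(2)
    by (auto intro!: map_idI simp: transpose_def)
  finally have tc: "?t \<circ> c permutes set (a # u @ y # v) \<and> map (?t \<circ> c) (a # u @ y # v) = y # a # u @ v"
    using permutes_compose[OF c' t] by blast
 have "sign (?t \<circ> c) = sign ?t * sign c"
    by (rule sign_compose[OF permutes_imp_permutation[OF finite_set t]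
          permutes_imp_permutation[OF finite_set c']])
  moreover have "a \<noteq> y" using Cons.prems by auto
  ultimately have sg: "sign (?t \<circ> c) = (- 1) ^ length (a # u)"
    using c(3) by (simp only: sign_swap_id if_False) simp
  show ?case
    unfolding append_Cons
    by (rule exI[of _ "?t \<circ> c"], intro conjI)
      (rule tc[THEN conjunct1, unfolded append_Cons], rule tc[THEN conjunct2, unfolded append_Cons], rule sg)
qed

text \<open>A cycle brings the first letter \<open>y\<close> of \<open>w\<close> to the front and
  the rest is permuted by induction. In the sorted list the letters before \<open>y\<close> are the
  smaller ones, so the sign of the cycle is the contribution of \<open>y\<close> to the
  inversions.\<close>

lemma ex_permutes_inversion_prod:
  assumes "sorted_wrt (<) l" "w \<in> permutations_of_set (set l)"
  shows "\<exists>p. p permutes set l \<and> map p l = w \<and> sign p = inversion_prod (\<lambda>_ _. - 1) w"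
  using assms
proof (induction w arbitrary: l)
  case Nil
  then have "l = []" by (auto dest: permutations_of_setD)
  then show ?case by (intro exI[of _ id]) (auto simp: id_def[symmetric] permutes_id)
next
  case (Cons y w)
  have w: "set (y # w) = set l" "distinct (y # w)"
    using permutations_of_setD[OF Cons.prems(2)] by auto
  then have "y \<in> set l" by auto
  then obtain u v where l: "l = u @ y # v" by (metis split_list)
  have d: "distinct l" using Cons.prems strict_sorted_iff by blast
  have uv: "set (u @ v) = set w" using w d by (auto simp: l)
  have "sorted_wrt (<) (u @ v)" using Cons.prems(1) by (simp add: l sorted_wrt_append)
  moreover have "w \<in> permutations_of_set (set (u @ v))" using w uv by auto
  ultimately obtain p where p: "p permutes set (u @ v)" "map p (u @ v) = w"
    "sign p = inversion_prod (\<lambda>_ _. - 1) w" using Cons.IH by blast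
  obtain c where c: "c permutes set l" "map c l = y # u @ v" "sign c = (- 1) ^ length u"
    using ex_permutes_move_front[of u y v] d by (auto simp: l)
  have p': "p permutes set l" using p(1) by (rule permutes_subset) (auto simp: l)
  have py: "p y = y" using p(1) w(2) uv by (intro permutes_not_in) auto
  have "map (p \<circ> c) l = map p (map c l)" by simp
  also have "\<dots> = y # w" unfolding c(2) using p(2) py by simp
  finally have pc: "p \<circ> c permutes set l \<and> map (p \<circ> c) l = y # w"
    using permutes_compose[OF c(1) p'] by blast
 have "sign (p \<circ> c) = sign p * sign c"
    by (rule sign_compose[OF permutes_imp_permutation[OF finite_set p']
          permutes_imp_permutation[OF finite_set c(1)]])
  moreover have "{z \<in> set w. z < y} = set u"
    using Cons.prems(1) unfolding uv[symmetric] l by (auto simp: sorted_wrt_append)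
  moreover have "card (set u) = length u" using d by (simp add: l distinct_card)
  ultimately have sg: "sign (p \<circ> c) = inversion_prod (\<lambda>_ _. - 1) (y # w)"
    using c(3) p(3) by (simp only: inversion_prod.simps prod_constant mult.commute)
  show ?case
    by (rule exI[of _ "p \<circ> c"], intro conjI) (rule conjunct1[OF pc], rule conjunct2[OF pc], rule sg)
qed

lemma map_permutes_inj:
  assumes "p permutes set l" "q permutes set l" "map p l = map q l"
  shows "p = q"
proof
  fix i show "p i = q i"
    using assms by (cases "i \<in> set l") (auto simp: permutes_not_in)
qed

lemma map_permutes_in_permutations_of_set:
  "distinct l \<Longrightarrow> p permutes set l \<Longrightarrow> map p l \<in> permutations_of_set (set l)"
  by (auto simp: permutations_of_set_def permutes_image distinct_map
      intro: permutes_inj_on simp flip: image_set)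

text \<open>A permutation is determined by its word, so the one constructed from
  \<open>map p l\<close> is \<open>p\<close> itself.\<close>

lemma sign_eq_inversion_prod:
  assumes "sorted_wrt (<) l" "p permutes set l"
  shows "sign p = inversion_prod (\<lambda>_ _. - 1) (map p l)"
proof -
  have "distinct l" using assms strict_sorted_iff by blast
  then obtain q where "q permutes set l" "map q l = map p l"
    "sign q = inversion_prod (\<lambda>_ _. - 1) (map p l)"
    using ex_permutes_inversion_prod[OF assms(1)] map_permutes_in_permutations_of_set assms(2)
    by blast
  moreover from this have "q = p" using assms(2) by (intro map_permutes_inj)
  ultimately show ?thesis by simp
qed

lemma bij_betw_map_permutes:
  assumes "sorted_wrt (<) (l :: nat list)"
  shows "bij_betw (\<lambda>p. map p l) {p. p permutes set l} (permutations_of_set (set l))"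
proof (intro bij_betw_imageI equalityI subsetI)
  have "distinct l" using assms strict_sorted_iff by blast
  then show "w \<in> permutations_of_set (set l)" if "w \<in> (\<lambda>p. map p l) ` {p. p permutes set l}" for w
    using that map_permutes_in_permutations_of_set by blast
  show "w \<in> (\<lambda>p. map p l) ` {p. p permutes set l}" if w: "w \<in> permutations_of_set (set l)" for w
  proof -
    obtain p where "p permutes set l" "map p l = w"
      using ex_permutes_inversion_prod[OF assms w] by blast
    then show ?thesis by blast
  qed
qed (rule inj_onI, simp only: mem_Collect_eq, rule map_permutes_inj)

text \<open>On each inversion the permutation contributes -1, and the scalars contribute -1 if both
  are odd; the product of the two is \<open>super_sign\<close>.\<close>

lemma sum_permutes_eq_super_alt:
  assumes "sorted_wrt (<) l"
  shows "(\<Sum>p | p permutes set l. sign p *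
      inversion_prod (\<lambda>i j. if fst (x i) \<and> fst (x j) then - 1 else 1) (map p l) * f (map x (map p l)))
    = super_alt (map x l) f"
proof -
  let ?s = "\<lambda>i j. if fst (x i) \<and> fst (x j) then - 1 else 1 :: int"
  have s: "inversion_prod (\<lambda>_ _. - 1) w * inversion_prod ?s w =
      inversion_prod (\<lambda>i j. super_sign (x i) (x j)) w" for w
    unfolding inversion_prod_mult[symmetric] by (simp add: super_sign_def if_distrib cong: if_cong)
  have "(\<Sum>p | p permutes set l. sign p * inversion_prod ?s (map p l) * f (map x (map p l)))
      = (\<Sum>p | p permutes set l. inversion_prod (\<lambda>i j. super_sign (x i) (x j)) (map p l)
          * f (map x (map p l)))"
    by (intro sum.cong refl) (simp add: sign_eq_inversion_prod[OF assms] s[symmetric] del: map_map)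
  also have "\<dots> = (\<Sum>w\<in>permutations_of_set (set l).
      inversion_prod (\<lambda>i j. super_sign (x i) (x j)) w * f (map x w))"
    by (rule sum.reindex_bij_betw[OF bij_betw_map_permutes[OF assms]])
  also have "\<dots> = super_alt (map x l) f"
    by (rule super_alt_eq_sum_permutations[OF assms, symmetric])
  finally show ?thesis .
qed

section \<open>Standard polynomials in rings\<close>

definition word_prod :: "('a, 'b) ring_scheme \<Rightarrow> ('i \<Rightarrow> 'a) \<Rightarrow> 'i list \<Rightarrow> 'a" where
  "word_prod A x l = foldr (\<lambda>i y. x i \<otimes>\<^bsub>A\<^esub> y) l \<one>\<^bsub>A\<^esub>"

lemma word_prod_Nil [simp]: "word_prod A x [] = \<one>\<^bsub>A\<^esub>"
  and word_prod_Cons [simp]: "word_prod A x (i # l) = x i \<otimes>\<^bsub>A\<^esub> word_prod A x l"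
  by (simp_all add: word_prod_def)

lemma word_prod_map: "word_prod A x (map g l) = word_prod A (x \<circ> g) l"
  by (induction l) simp_all

lemma word_prod_cong: "(\<And>i. i \<in> set l \<Longrightarrow> x i = y i) \<Longrightarrow> word_prod A x l = word_prod A y l"
  by (induction l) simp_all

lemma standard_poly_eq:
  "standard_poly A k x = (\<Oplus>\<^bsub>A\<^esub>p\<in>{p. p permutes {1..k}}. [sign p] \<cdot>\<^bsub>A\<^esub> word_prod A x (map p [1..<Suc k]))"
  by (simp add: standard_poly_def word_prod_def foldr_map o_def)

text \<open>Closure under addition suffices, because the generating sets in question absorb
  coefficients and hence signs.\<close>

inductive_set add_span :: "('a, 'b) ring_scheme \<Rightarrow> 'a set \<Rightarrow> 'a set" for A G where
  add_span_zero: "\<zero>\<^bsub>A\<^esub> \<in> add_span A G"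
| add_span_gen: "g \<in> G \<Longrightarrow> g \<in> add_span A G"
| add_span_add: "a \<in> add_span A G \<Longrightarrow> b \<in> add_span A G \<Longrightarrow> a \<oplus>\<^bsub>A\<^esub> b \<in> add_span A G"

lemma add_pow_int_0: "[(0 :: int)] \<cdot>\<^bsub>G\<^esub> a = \<zero>\<^bsub>G\<^esub>"
  by (simp add: add_pow_def)

lemma (in abelian_group) finsum_add_pow_left:
  assumes "finite S" "a \<in> carrier G"
  shows "(\<Oplus>s\<in>S. [(f s :: int)] \<cdot> a) = [(\<Sum>s\<in>S. f s)] \<cdot> a"
  using assms
  by (induction S rule: finite_induct) (auto simp: add_pow_int_0 add.int_pow_mult Pi_def)

lemma (in abelian_group) add_pow_add_pow:
  "a \<in> carrier G \<Longrightarrow> [(c :: int)] \<cdot> ([(d :: int)] \<cdot> a) = [(c * d)] \<cdot> a"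
  by (simp add: add.int_pow_pow mult.commute)

context ring
begin

lemma add_span_closed: "G \<subseteq> carrier R \<Longrightarrow> a \<in> add_span R G \<Longrightarrow> a \<in> carrier R"
  by (rotate_tac, induction rule: add_span.induct) auto

lemma add_span_finsum:
  assumes "finite S" "G \<subseteq> carrier R" "\<And>s. s \<in> S \<Longrightarrow> f s \<in> add_span R G"
  shows "(\<Oplus>s\<in>S. f s) \<in> add_span R G"
  using assms(1,3)
proof (induction S rule: finite_induct)
  case (insert s S)
  then have "f \<in> insert s S \<rightarrow> carrier R" using add_span_closed[OF assms(2)] by blast
  with insert show ?case by (auto intro: add_span_add)
qed (simp add: add_span_zero)

lemma word_prod_closed [intro, simp]: "(\<And>i. i \<in> set l \<Longrightarrow> x i \<in> carrier R) \<Longrightarrow> word_prod R x l \<in> carrier R"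
  by (induction l) auto

section \<open>Multilinearity of the standard polynomial\<close>

lemma word_prod_add:
  assumes "distinct l" "i \<in> set l" "\<And>j. j \<in> set l \<Longrightarrow> x j \<in> carrier R"
    and "a \<in> carrier R" "b \<in> carrier R"
  shows "word_prod R (x(i := a \<oplus> b)) l = word_prod R (x(i := a)) l \<oplus> word_prod R (x(i := b)) l"
  using assms(1-3)
proof (induction l)
  case (Cons j l)
  have cl: "word_prod R x l \<in> carrier R" "word_prod R (x(i := a)) l \<in> carrier R"
    "word_prod R (x(i := b)) l \<in> carrier R"
    using Cons.prems(3) assms(4,5) by auto
  show ?case
  proof (cases "j = i")
    case True
    then have "word_prod R (x(i := c)) l = word_prod R x l" for c
      using Cons.prems(1) by (intro word_prod_cong) auto
    then show ?thesis using True cl assms(4,5) by (simp add: l_distr fun_upd_same del: fun_upd_apply)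
  next
    case False
    then show ?thesis using Cons cl by (simp add: r_distr fun_upd_other del: fun_upd_apply)
  qed
qed simp

lemma standard_poly_closed [intro, simp]:
  "x \<in> {1..k} \<rightarrow> carrier R \<Longrightarrow> standard_poly R k x \<in> carrier R"
  unfolding standard_poly_eq
  by (intro finsum_closed Pi_I add.int_pow_closed word_prod_closed)
    (fastforce dest: permutes_in_image)

lemma standard_poly_add:
  assumes "i \<in> {1..k}" "x \<in> {1..k} \<rightarrow> carrier R" "a \<in> carrier R" "b \<in> carrier R"
  shows "standard_poly R k (x(i := a \<oplus> b)) = standard_poly R k (x(i := a)) \<oplus> standard_poly R k (x(i := b))"
proof -
  let ?L = "[1..<Suc k]"
  have L: "set ?L = {1..k}" by auto
  have cl: "word_prod R (x(i := c)) (map p ?L) \<in> carrier R" if "p permutes {1..k}" "c \<in> carrier R" for p c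
  proof (rule word_prod_closed)
    fix j assume "j \<in> set (map p ?L)"
    then have "j \<in> {1..k}" using permutes_image[OF that(1)] L by (metis image_set)
    then show "(x(i := c)) j \<in> carrier R" using assms that by auto
  qed
  have w: "word_prod R (x(i := a \<oplus> b)) (map p ?L) =
      word_prod R (x(i := a)) (map p ?L) \<oplus> word_prod R (x(i := b)) (map p ?L)"
    if p: "p permutes {1..k}" for p
  proof (rule word_prod_add)
    have "set (map p ?L) = {1..k}" using permutes_image[OF p] L by (metis image_set)
    then show "i \<in> set (map p ?L)" "\<And>j. j \<in> set (map p ?L) \<Longrightarrow> x j \<in> carrier R"
      using assms by auto
    show "distinct (map p ?L)"
      using permutes_inj_on[OF p] by (simp add: distinct_map)
  qed (use assms in auto)
  have "standard_poly R k (x(i := a \<oplus> b)) = (\<Oplus>p\<in>{p. p permutes {1..k}}.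
      [sign p] \<cdot> word_prod R (x(i := a)) (map p ?L) \<oplus> [sign p] \<cdot> word_prod R (x(i := b)) (map p ?L))"
    unfolding standard_poly_eq
    by (intro finsum_cong')
      (use assms cl in \<open>auto simp: w add.int_pow_mult_distrib a_comm
        simp del: upt_Suc fun_upd_apply One_nat_def\<close>)
  also have "\<dots> = standard_poly R k (x(i := a)) \<oplus> standard_poly R k (x(i := b))"
    unfolding standard_poly_eq
    by (intro finsum_addf) (use assms cl in \<open>auto simp del: upt_Suc fun_upd_apply One_nat_def\<close>)
  finally show ?thesis .
qed

text \<open>Multilinearity, applied to one argument at a time: the induction frees the first
  \<open>j\<close> arguments and keeps the others in \<open>G\<close>.\<close>

lemma standard_identity_add_span:
  assumes G: "G \<subseteq> carrier R" and span: "carrier R \<subseteq> add_span R G"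
    and eq0: "\<And>x. x \<in> {1..k} \<rightarrow> G \<Longrightarrow> standard_poly R k x = \<zero>"
  shows "standard_identity R k"
proof -
  have "standard_poly R k x = \<zero>"
    if "j \<le> k" "x \<in> {1..j} \<rightarrow> carrier R" "x \<in> {Suc j..k} \<rightarrow> G" for j x
    using that
  proof (induction j arbitrary: x)
    case 0
    then show ?case by (intro eq0) auto
  next
    case (Suc j)
    have x: "x \<in> {1..k} \<rightarrow> carrier R"
    proof
      fix i assume "i \<in> {1..k}"
      then show "x i \<in> carrier R" using Suc.prems G by (cases "i \<le> Suc j") (auto simp: Pi_iff)
    qed
    have "standard_poly R k (x(Suc j := a)) = \<zero>" if "a \<in> add_span R G" for a
      using that
    proof induction
      case add_span_zero
      \<comment> \<open>Additivity at \<open>\<zero> \<oplus> \<zero>\<close> makes the value equal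
        to its own double, so it is zero.\<close>
      have "standard_poly R k (x(Suc j := \<zero> \<oplus> \<zero>)) =
          standard_poly R k (x(Suc j := \<zero>)) \<oplus> standard_poly R k (x(Suc j := \<zero>))"
        by (rule standard_poly_add) (use x Suc.prems in auto)
      moreover have "standard_poly R k (x(Suc j := \<zero>)) \<in> carrier R"
        by (rule standard_poly_closed) (use x in auto)
      ultimately show ?case by (metis add.l_cancel_one' l_zero zero_closed)
    next
      case (add_span_gen g)
      then show ?case using Suc.prems G by (intro Suc.IH) (auto simp: Pi_iff)
    next
      case (add_span_add a b)
      have "a \<in> carrier R" "b \<in> carrier R"
        using add_span_closed[OF G] add_span_add by auto
      then show ?case
        using x Suc.prems add_span_add.IH
        by (subst standard_poly_add) (auto simp del: fun_upd_apply One_nat_def)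
    qed
    from this[of "x (Suc j)"] show ?case
      using Pi_mem[OF x, of "Suc j"] span Suc.prems(1) by auto
  qed
  from this[of k] show ?thesis
    unfolding standard_identity_def by auto
qed

section \<open>Reordering products whose factors commute up to integers\<close>

lemma word_prod_insort:
  fixes x :: "nat \<Rightarrow> 'a"
  assumes "\<And>i j. i \<in> insert y (set l) \<Longrightarrow> j \<in> insert y (set l) \<Longrightarrow> x i \<otimes> x j = [(s i j :: int)] \<cdot> (x j \<otimes> x i)"
    and "\<And>i. i \<in> insert y (set l) \<Longrightarrow> x i \<in> carrier R"
    and "sorted l" "distinct l" "y \<notin> set l"
  shows "x y \<otimes> word_prod R x l = [(\<Prod>z\<in>{z\<in>set l. z < y}. s y z)] \<cdot> word_prod R x (insort y l)"
  using assms
proof (induction l)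
  case (Cons a l)
  have cl: "x y \<in> carrier R" "x a \<in> carrier R" "word_prod R x l \<in> carrier R"
    "word_prod R x (insort y l) \<in> carrier R"
    using Cons.prems(2) by (auto intro!: word_prod_closed simp: set_insort_key)
  show ?case
  proof (cases "y < a")
    case True
    then have "{z \<in> set (a # l). z < y} = {}" using Cons.prems(3) by auto
    then have "(\<Prod>z\<in>{z \<in> set (a # l). z < y}. s y z) = 1" by (simp only: prod.empty)
    then show ?thesis using True cl by (simp add: less_imp_le del: list.set)
  next
    case False
    with Cons.prems have ay: "a < y" by auto
    then have e: "{z \<in> set (a # l). z < y} = insert a {z \<in> set l. z < y}" by auto
    have "a \<notin> {z \<in> set l. z < y}" using Cons.prems(4) by auto
    then have K: "(\<Prod>z\<in>{z \<in> set (a # l). z < y}. s y z) = s y a * (\<Prod>z\<in>{z\<in>set l. z < y}. s y z)"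
      unfolding e by (subst prod.insert) auto
    have IH: "x y \<otimes> word_prod R x l = [(\<Prod>z\<in>{z\<in>set l. z < y}. s y z)] \<cdot> word_prod R x (insort y l)"
      by (rule Cons.IH) (use Cons.prems in auto)
    have "x y \<otimes> word_prod R x (a # l) = (x y \<otimes> x a) \<otimes> word_prod R x l"
      using cl by (simp add: m_assoc)
    also have "\<dots> = [s y a] \<cdot> (x a \<otimes> x y) \<otimes> word_prod R x l"
      using Cons.prems(1)[of y a] by simp
    also have "\<dots> = [s y a] \<cdot> (x a \<otimes> (x y \<otimes> word_prod R x l))"
      using cl by (simp add: add_pow_ldistr_int m_assoc)
    also have "\<dots> = [(s y a * (\<Prod>z\<in>{z\<in>set l. z < y}. s y z))] \<cdot> (x a \<otimes> word_prod R x (insort y l))"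
      unfolding IH using cl by (simp add: add_pow_rdistr_int add_pow_add_pow)
    finally show ?thesis using False ay less_le_not_le[of a y] by (simp add: K del: list.set)
  qed
qed simp

text \<open>Insertion sort: inserting \<open>y\<close> into the sorted remainder moves
  \<open>x y\<close> past the factors of smaller index, which are its inversions.\<close>

lemma word_prod_sort:
  assumes "\<And>i j. i \<in> set w \<Longrightarrow> j \<in> set w \<Longrightarrow> x i \<otimes> x j = [(s i j :: int)] \<cdot> (x j \<otimes> x i)"
    and "\<And>i. i \<in> set w \<Longrightarrow> x i \<in> carrier R" and "distinct w"
  shows "word_prod R x w = [inversion_prod s w] \<cdot> word_prod R x (sort w)"
  using assms
proof (induction w)
  case (Cons y w)
  have cl: "word_prod R x (sort w) \<in> carrier R" "word_prod R x (sort (y # w)) \<in> carrier R" "x y \<in> carrier R"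
    using Cons.prems(2) by (auto intro!: word_prod_closed simp: set_insort_key)
  have IH: "word_prod R x w = [inversion_prod s w] \<cdot> word_prod R x (sort w)"
  proof (rule Cons.IH)
    show "x i \<otimes> x j = [(s i j)] \<cdot> (x j \<otimes> x i)" if "i \<in> set w" "j \<in> set w" for i j
      using that by (intro Cons.prems(1)) auto
  qed (use Cons.prems(2,3) in auto)
  have "word_prod R x (y # w) = [inversion_prod s w] \<cdot> (x y \<otimes> word_prod R x (sort w))"
    using IH cl by (simp add: add_pow_rdistr_int)
  also have "x y \<otimes> word_prod R x (sort w) = [(\<Prod>z\<in>{z\<in>set w. z < y}. s y z)] \<cdot> word_prod R x (sort (y # w))"
  proof -
    have "x y \<otimes> word_prod R x (sort w) =
      [(\<Prod>z\<in>{z\<in>set (sort w). z < y}. s y z)] \<cdot> word_prod R x (insort y (sort w))"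
    proof (rule word_prod_insort)
      show "x i \<otimes> x j = [(s i j)] \<cdot> (x j \<otimes> x i)"
        if "i \<in> insert y (set (sort w))" "j \<in> insert y (set (sort w))" for i j
        using that by (intro Cons.prems(1)) auto
    qed (use Cons.prems(2,3) in auto)
    then show ?thesis by simp
  qed
  finally show ?case using cl by (simp add: add_pow_add_pow mult.commute del: sort_key_simps)
qed simp

end

section \<open>Matrices over a graded ring\<close>

text \<open>
  The label \<open>(1, 1)\<close> stands for the identity matrix and every other label for its matrix unit, so
  that the \<open>n\<^sup>2\<close> labels form a basis of the integer matrices that contains the identity.
\<close>

definition unit_entry :: "nat \<times> nat \<Rightarrow> nat \<times> nat \<Rightarrow> int" where
  "unit_entry b ij = (if b = (1, 1) then of_bool (fst ij = snd ij) else of_bool (ij = b))"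

text \<open>These are the entries of a product of integer basis matrices. Keeping them apart from
  the scalars allows the vanishing to be proved over the integers, independently of the coefficient
  ring.\<close>

fun word_entry :: "nat \<Rightarrow> (nat \<times> nat) list \<Rightarrow> nat \<times> nat \<Rightarrow> int" where
  "word_entry n [] (i, j) = of_bool (i = j)"
| "word_entry n (b # w) (i, j) = (\<Sum>t\<in>{1..n}. unit_entry b (i, t) * word_entry n w (t, j))"

lemma word_entry_identity:
  "i \<in> {1..n} \<Longrightarrow> word_entry n (us @ (1, 1) # vs) (i, j) = word_entry n (us @ vs) (i, j)"
proof (induction us arbitrary: i)
  case Nil
  have "(\<Sum>t\<in>{1..n}. unit_entry (1, 1) (i, t) * word_entry n vs (t, j)) =
      (\<Sum>t\<in>{1..n}. if i = t then word_entry n vs (t, j) else 0)"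
    by (intro sum.cong) (auto simp: unit_entry_def)
  with Nil show ?case by simp
next
  case (Cons b us)
  have "(\<Sum>t\<in>{1..n}. unit_entry b (i, t) * word_entry n (us @ (1, 1) # vs) (t, j)) =
      (\<Sum>t\<in>{1..n}. unit_entry b (i, t) * word_entry n (us @ vs) (t, j))"
    by (intro sum.cong refl arg_cong2[where f = times] Cons.IH)
  then show ?case by simp
qed

definition scalar_unit :: "nat \<Rightarrow> ('a, 'b) ring_scheme \<Rightarrow> 'a \<Rightarrow> nat \<times> nat \<Rightarrow> nat \<times> nat \<Rightarrow> 'a" where
  "scalar_unit n A c b = (\<lambda>ij\<in>{1..n} \<times> {1..n}. [unit_entry b ij] \<cdot>\<^bsub>A\<^esub> c)"

text \<open>Here \<open>N\<close> is the number of basis labels, and \<open>p\<close> and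
  \<open>r\<close> count the even and odd letters. Rounding gives \<open>N \<le> 2 * a\<close> and
  \<open>m \<le> 2 * b + 1\<close>, so \<open>p\<close> is at least \<open>N - 1\<close>; an even
  \<open>r\<close> is at most \<open>2 * b\<close>, which forces \<open>p\<close> to be at least
  \<open>N\<close>.\<close>

lemma standard_degree_parity:
  fixes N p r m :: nat
  assumes "p + r = 2 * ((N + 1) div 2 + m div 2)" "r \<le> m"
  shows "N \<le> Suc p" and "N = Suc p \<Longrightarrow> odd r"
proof -
  define a b where "a = (N + 1) div 2" and "b = m div 2"
  then have N: "N \<le> 2 * a" and m: "m \<le> 2 * b + 1" by linarith+
  have pr: "p + r = 2 * a + 2 * b" using assms(1) by (simp add: a_def b_def)
  show "N \<le> Suc p" using assms(2) pr N m by linarith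
  show "odd r" if "N = Suc p"
  proof
    assume "even r"
    then have "r \<le> 2 * b" using assms(2) m by (auto elim!: evenE)
    then show False using pr N that by linarith
  qed
qed

context ring
begin

section \<open>Entrywise computation in the matrix ring\<close>

lemma matrix_ring_closedD:
  "X \<in> carrier (matrix_ring n R) \<Longrightarrow> i \<in> {1..n} \<Longrightarrow> j \<in> {1..n} \<Longrightarrow> X (i, j) \<in> carrier R"
  by (auto simp: matrix_ring_def)

lemma matrix_ring_eqI:
  assumes "X \<in> carrier (matrix_ring n R)" "Y \<in> carrier (matrix_ring n R)"
    "\<And>i j. i \<in> {1..n} \<Longrightarrow> j \<in> {1..n} \<Longrightarrow> X (i, j) = Y (i, j)"
  shows "X = Y"
proof (rule PiE_ext)
  show "X \<in> {1..n} \<times> {1..n} \<rightarrow>\<^sub>E carrier R" "Y \<in> {1..n} \<times> {1..n} \<rightarrow>\<^sub>E carrier R"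
    using assms by (auto simp: matrix_ring_def)
qed (use assms(3) in auto)

lemma matrix_ring_entry_hom:
  "i \<in> {1..n} \<Longrightarrow> j \<in> {1..n} \<Longrightarrow> (\<lambda>X. X (i, j)) \<in> hom (add_monoid (matrix_ring n R)) (add_monoid R)"
  by (rule homI) (auto simp: matrix_ring_def)

lemma matrix_ring_add_pow_entry:
  assumes "X \<in> carrier (matrix_ring n R)" "i \<in> {1..n}" "j \<in> {1..n}"
  shows "([(z :: int)] \<cdot>\<^bsub>matrix_ring n R\<^esub> X) (i, j) = [z] \<cdot> X (i, j)"
proof -
  interpret M: ring "matrix_ring n R" by (rule ring_matrix_ring)
  show ?thesis
    using hom_int_pow[OF matrix_ring_entry_hom[OF assms(2,3)] _ M.a_group a_group, of X z] assms(1)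
    by (simp add: add_pow_def)
qed

lemma matrix_ring_add_entry:
  "i \<in> {1..n} \<Longrightarrow> j \<in> {1..n} \<Longrightarrow> (X \<oplus>\<^bsub>matrix_ring n R\<^esub> Y) (i, j) = X (i, j) \<oplus> Y (i, j)"
  by (simp add: matrix_ring_def)

lemma matrix_ring_finsum_entry:
  assumes "finite S" "f \<in> S \<rightarrow> carrier (matrix_ring n R)" "i \<in> {1..n}" "j \<in> {1..n}"
  shows "(\<Oplus>\<^bsub>matrix_ring n R\<^esub>s\<in>S. f s) (i, j) = (\<Oplus>s\<in>S. f s (i, j))"
proof -
  interpret M: ring "matrix_ring n R" by (rule ring_matrix_ring)
  show ?thesis
    using assms(1,2)
  proof (induction S rule: finite_induct)
    case empty
    have "\<zero>\<^bsub>matrix_ring n R\<^esub> (i, j) = \<zero>" using assms by (simp add: matrix_ring_def)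
    then show ?case by simp
  next
    case (insert s S)
    moreover have "(\<lambda>s. f s (i, j)) \<in> S \<rightarrow> carrier R" "f s (i, j) \<in> carrier R"
      using insert.prems assms(3,4) matrix_ring_closedD by blast+
    ultimately show ?case
      using matrix_ring_add_entry[OF assms(3,4)] by (simp add: Pi_def)
  qed
qed

lemma scalar_unit_closed: "c \<in> carrier R \<Longrightarrow> scalar_unit n R c b \<in> carrier (matrix_ring n R)"
  by (auto simp: scalar_unit_def matrix_ring_def)

lemma scalar_unit_entry:
  "i \<in> {1..n} \<Longrightarrow> j \<in> {1..n} \<Longrightarrow> scalar_unit n R c b (i, j) = [unit_entry b (i, j)] \<cdot> c"
  by (simp add: scalar_unit_def)

text \<open>Integer factors are central and can be collected in front, while the scalars keep their
  order.\<close>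

lemma word_prod_scalar_unit:
  assumes "\<And>s. s \<in> set l \<Longrightarrow> c s \<in> carrier R" "i \<in> {1..n}" "j \<in> {1..n}"
  shows "word_prod (matrix_ring n R) (\<lambda>s. scalar_unit n R (c s) (b s)) l (i, j) =
    [word_entry n (map b l) (i, j)] \<cdot> word_prod R c l"
  using assms(1,2)
proof (induction l arbitrary: i)
  case Nil
  then show ?case using assms(3) by (auto simp: matrix_ring_def add_pow_int_0)
next
  case (Cons s l)
  have cl: "c s \<in> carrier R" "word_prod R c l \<in> carrier R" using Cons.prems by auto
  have "word_prod (matrix_ring n R) (\<lambda>s. scalar_unit n R (c s) (b s)) (s # l) (i, j) =
    (\<Oplus>t\<in>{1..n}. scalar_unit n R (c s) (b s) (i, t) \<otimes>
       word_prod (matrix_ring n R) (\<lambda>s. scalar_unit n R (c s) (b s)) l (t, j))"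
    using Cons.prems(2) assms(3) by (simp add: matrix_ring_def)
  also have "\<dots> = (\<Oplus>t\<in>{1..n}. [(unit_entry (b s) (i, t) * word_entry n (map b l) (t, j))] \<cdot>
      (c s \<otimes> word_prod R c l))"
  proof (rule finsum_cong')
    fix t assume t: "t \<in> {1..n}"
    have "word_prod (matrix_ring n R) (\<lambda>s. scalar_unit n R (c s) (b s)) l (t, j) =
      [word_entry n (map b l) (t, j)] \<cdot> word_prod R c l"
      using Cons t by simp
    then show "scalar_unit n R (c s) (b s) (i, t) \<otimes>
        word_prod (matrix_ring n R) (\<lambda>s. scalar_unit n R (c s) (b s)) l (t, j) =
      [(unit_entry (b s) (i, t) * word_entry n (map b l) (t, j))] \<cdot> (c s \<otimes> word_prod R c l)"
      using cl t Cons.prems(2)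
      by (simp add: scalar_unit_entry add_pow_ldistr_int add_pow_rdistr_int add_pow_add_pow mult.commute
          del: atLeastAtMost_iff)
  qed (use cl in auto)
  also have "\<dots> = [word_entry n (map b (s # l)) (i, j)] \<cdot> (c s \<otimes> word_prod R c l)"
    using cl by (simp add: finsum_add_pow_left)
  finally show ?case by simp
qed

text \<open>Sorting the scalars extracts a sign for each inversion. Then only an integer depends on
  the permutation, and the sum of these integers is a \<open>super_alt\<close>.\<close>

lemma standard_poly_scalar_unit:
  fixes c :: "nat \<Rightarrow> 'a"
  assumes c: "\<And>s. s \<in> {1..k} \<Longrightarrow> c s \<in> carrier R"
    and comm: "\<And>s t. s \<in> {1..k} \<Longrightarrow> t \<in> {1..k} \<Longrightarrow>
      c s \<otimes> c t = [(if e s \<and> e t then - 1 else 1 :: int)] \<cdot> (c t \<otimes> c s)"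
    and ij: "i \<in> {1..n}" "j \<in> {1..n}"
  shows "standard_poly (matrix_ring n R) k (\<lambda>s. scalar_unit n R (c s) (b s)) (i, j) =
    [super_alt (map (\<lambda>s. (e s, b s)) [1..<Suc k]) (\<lambda>u. word_entry n (map snd u) (i, j))] \<cdot>
      word_prod R c [1..<Suc k]"
proof -
  interpret M: ring "matrix_ring n R" by (rule ring_matrix_ring)
  define L where "L = [1..<Suc k]"
  have L: "set L = {1..k}" "sorted_wrt (<) L" unfolding L_def by (auto simp del: upt_Suc)
  let ?x = "\<lambda>s. scalar_unit n R (c s) (b s)"
  let ?s = "\<lambda>s t. if e s \<and> e t then - 1 else 1 :: int"
  have pL: "set (map p L) = {1..k}" "distinct (map p L)" "sort (map p L) = L" if p: "p permutes {1..k}" for p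
  proof -
    show s: "set (map p L) = {1..k}" using permutes_image[OF p] L by (metis image_set)
    show d: "distinct (map p L)"
      using permutes_inj_on[OF p] by (simp add: distinct_map L_def)
    show "sort (map p L) = L"
      by (rule sorted_distinct_set_unique) (use s d L in \<open>auto simp: L_def simp del: upt_Suc\<close>)
  qed
  have W: "word_prod (matrix_ring n R) ?x (map p L) \<in> carrier (matrix_ring n R)" if "p permutes {1..k}" for p
  proof (rule M.word_prod_closed)
    fix s assume "s \<in> set (map p L)"
    then show "?x s \<in> carrier (matrix_ring n R)"
      unfolding pL(1)[OF that] by (intro scalar_unit_closed c)
  qed
  have C: "word_prod R c L \<in> carrier R" using c L by auto
  have E: "word_prod (matrix_ring n R) ?x (map p L) (i, j) =
    [(word_entry n (map b (map p L)) (i, j) * inversion_prod ?s (map p L))] \<cdot> word_prod R c L"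
    if p: "p permutes {1..k}" for p
  proof -
    have "word_prod R c (map p L) = [inversion_prod ?s (map p L)] \<cdot> word_prod R c (sort (map p L))"
    proof (rule word_prod_sort)
      show "c s \<otimes> c t = [(?s s t)] \<cdot> (c t \<otimes> c s)" if "s \<in> set (map p L)" "t \<in> set (map p L)" for s t
        using that unfolding pL(1)[OF p] by (rule comm)
      show "c s \<in> carrier R" if "s \<in> set (map p L)" for s
        using that unfolding pL(1)[OF p] by (rule c)
      show "distinct (map p L)" by (rule pL(2)[OF p])
    qed
    moreover have "word_prod (matrix_ring n R) ?x (map p L) (i, j) =
        [word_entry n (map b (map p L)) (i, j)] \<cdot> word_prod R c (map p L)"
    proof (rule word_prod_scalar_unit[OF _ ij])
      show "c s \<in> carrier R" if "s \<in> set (map p L)" for s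
        using that unfolding pL(1)[OF p] by (rule c)
    qed
    ultimately show ?thesis using C by (simp only: pL(3)[OF p] add_pow_add_pow)
  qed
  have "standard_poly (matrix_ring n R) k ?x (i, j) =
    (\<Oplus>p\<in>{p. p permutes {1..k}}. ([sign p] \<cdot>\<^bsub>matrix_ring n R\<^esub> word_prod (matrix_ring n R) ?x (map p L)) (i, j))"
    unfolding standard_poly_eq L_def[symmetric]
    by (rule matrix_ring_finsum_entry) (use W ij in \<open>auto simp: finite_permutations\<close>)
  also have "\<dots> = (\<Oplus>p\<in>{p. p permutes {1..k}}.
     [(sign p * inversion_prod ?s (map p L) * word_entry n (map b (map p L)) (i, j))] \<cdot> word_prod R c L)"
    by (rule finsum_cong')
      (use C in \<open>simp_all add: matrix_ring_add_pow_entry[OF W ij] E add_pow_add_pow mult_ac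
        del: map_map One_nat_def\<close>)
  also have "\<dots> = [(\<Sum>p | p permutes {1..k}. sign p * inversion_prod ?s (map p L) *
      word_entry n (map b (map p L)) (i, j))] \<cdot> word_prod R c L"
    by (rule finsum_add_pow_left) (simp_all add: finite_permutations C)
  also have "(\<Sum>p | p permutes {1..k}. sign p * inversion_prod ?s (map p L) *
      word_entry n (map b (map p L)) (i, j)) =
      super_alt (map (\<lambda>s. (e s, b s)) L) (\<lambda>u. word_entry n (map snd u) (i, j))"
    using sum_permutes_eq_super_alt[OF L(2), of "\<lambda>s. (e s, b s)" "\<lambda>u. word_entry n (map snd u) (i, j)"]
    unfolding L(1) by (simp add: o_def)
  finally show ?thesis unfolding L_def .
qed

lemma carrier_matrix_ring_subset_add_span:
  assumes G: "G \<subseteq> carrier R" and span: "carrier R \<subseteq> add_span R G" and n: "n \<ge> 1"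
  shows "carrier (matrix_ring n R) \<subseteq>
    add_span (matrix_ring n R) {scalar_unit n R c b | c b. c \<in> G \<and> b \<in> {1..n} \<times> {1..n}}"
    (is "_ \<subseteq> add_span ?M ?G")
proof
  interpret M: ring ?M by (rule ring_matrix_ring)
  have GM: "?G \<subseteq> carrier ?M" using G scalar_unit_closed by blast
  have s: "scalar_unit n R a b \<in> add_span ?M ?G" if "a \<in> carrier R" and b: "b \<in> {1..n} \<times> {1..n}" for a b
  proof -
    from that span have "a \<in> add_span R G" by blast
    then show ?thesis
    proof induction
      case add_span_zero
      have "scalar_unit n R \<zero> b = \<zero>\<^bsub>?M\<^esub>"
        by (rule ext) (auto simp: scalar_unit_def matrix_ring_def)
      then show ?case by (simp add: add_span.add_span_zero)
    next
      case (add_span_gen g)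
      then show ?case using b by (intro add_span.add_span_gen) blast
    next
      case (add_span_add x y)
      then have "x \<in> carrier R" "y \<in> carrier R" using add_span_closed[OF G] by auto
      then have "scalar_unit n R (x \<oplus> y) b = scalar_unit n R x b \<oplus>\<^bsub>?M\<^esub> scalar_unit n R y b"
        by (intro ext) (auto simp: scalar_unit_def matrix_ring_def add.int_pow_mult_distrib a_comm)
      then show ?case using add_span_add by (simp add: add_span.add_span_add)
    qed
  qed
  fix X assume X: "X \<in> carrier ?M"
  let ?B = "{1..n} \<times> {1..n} - {(1, 1)}"
  \<comment> \<open>The label \<open>(1, 1)\<close> stands for the identity, so splitting off
    \<open>X (1, 1)\<close> times the identity also subtracts \<open>X (1, 1)\<close> from the other
    diagonal entries.\<close>
  define y where "y b = X b \<ominus> [(of_bool (fst b = snd b) :: int)] \<cdot> X (1, 1)" for b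
  have X11: "X (1, 1) \<in> carrier R" using X n by (intro matrix_ring_closedD) auto
  have y: "y b \<in> carrier R" if "b \<in> {1..n} \<times> {1..n}" for b
    unfolding y_def using that matrix_ring_closedD[OF X, of "fst b" "snd b"] X11 by auto
  let ?S = "\<Oplus>\<^bsub>?M\<^esub>b\<in>?B. scalar_unit n R (y b) b"
  have Scl: "(\<lambda>b. scalar_unit n R (y b) b) \<in> ?B \<rightarrow> carrier ?M"
    using y by (auto intro!: scalar_unit_closed)
  have Xeq: "X = scalar_unit n R (X (1, 1)) (1, 1) \<oplus>\<^bsub>?M\<^esub> ?S"
  proof (rule matrix_ring_eqI[OF X])
    show "scalar_unit n R (X (1, 1)) (1, 1) \<oplus>\<^bsub>?M\<^esub> ?S \<in> carrier ?M"
      by (intro M.a_closed M.finsum_closed Scl scalar_unit_closed X11)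
    fix i j assume ij: "i \<in> {1..n}" "j \<in> {1..n}"
    have Xij: "X (i, j) \<in> carrier R" using X ij by (rule matrix_ring_closedD)
    have "?S (i, j) = (\<Oplus>b\<in>?B. scalar_unit n R (y b) b (i, j))"
      by (rule matrix_ring_finsum_entry) (use Scl ij in auto)
    also have "\<dots> = (\<Oplus>b\<in>?B. if (i, j) = b then y b else \<zero>)"
      by (rule finsum_cong')
        (use y ij in \<open>auto simp: scalar_unit_entry unit_entry_def add_pow_int_0\<close>)
    also have "\<dots> = (if (i, j) = (1, 1) then \<zero> else y (i, j))"
    proof (cases "(i, j) = (1, 1)")
      case True
      then have "(if (i, j) = b then y b else \<zero>) = \<zero>" if "b \<in> ?B" for b using that by auto
      then show ?thesis unfolding if_P[OF True] by (rule add.finprod_one_eqI)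
    next
      case False
      then have "(\<Oplus>b\<in>?B. if (i, j) = b then y b else \<zero>) = y (i, j)"
        by (intro finsum_singleton) (use y ij in blast)+
      then show ?thesis using False by (simp only: if_False)
    qed
    finally have S: "?S (i, j) = (if (i, j) = (1, 1) then \<zero> else y (i, j))" .
    have *: "(scalar_unit n R (X (1, 1)) (1, 1) \<oplus>\<^bsub>?M\<^esub> ?S) (i, j) =
        [(of_bool (i = j) :: int)] \<cdot> X (1, 1) \<oplus> ?S (i, j)"
      unfolding matrix_ring_add_entry[OF ij] scalar_unit_entry[OF ij]
      by (simp add: unit_entry_def)
    have cancel: "a \<oplus> (x \<ominus> a) = x" if "a \<in> carrier R" "x \<in> carrier R" for a x
      using that by (simp add: a_minus_def a_comm[of x] r_neg2)
    show "X (i, j) = (scalar_unit n R (X (1, 1)) (1, 1) \<oplus>\<^bsub>?M\<^esub> ?S) (i, j)"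
    proof (cases "(i, j) = (1, 1)")
      case True
      then have "?S (i, j) = \<zero>" unfolding S by (rule if_P)
      moreover have "[(of_bool (i = j) :: int)] \<cdot> X (1, 1) = X (i, j)"
      proof -
        have "i = 1" "j = 1" using True by auto
        then show ?thesis using X11 by simp
      qed
      ultimately show ?thesis unfolding * by (simp only: r_zero[OF Xij])
    next
      case False
      then have "?S (i, j) = y (i, j)" unfolding S by (rule if_not_P)
      also have "\<dots> = X (i, j) \<ominus> [(of_bool (i = j) :: int)] \<cdot> X (1, 1)" by (simp add: y_def)
      finally have F: "?S (i, j) = X (i, j) \<ominus> [(of_bool (i = j) :: int)] \<cdot> X (1, 1)" .
      show ?thesis
        unfolding * F by (rule cancel[OF add.int_pow_closed[OF X11] Xij, symmetric])
    qed
  qed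
  have "?S \<in> add_span ?M ?G"
  proof (rule M.add_span_finsum[OF _ GM])
    show "scalar_unit n R (y b) b \<in> add_span ?M ?G" if "b \<in> ?B" for b
      using that by (intro s y) blast+
  qed simp
  moreover have "scalar_unit n R (X (1, 1)) (1, 1) \<in> add_span ?M ?G"
    by (rule s[OF X11]) (use n in auto)
  ultimately have "scalar_unit n R (X (1, 1)) (1, 1) \<oplus>\<^bsub>?M\<^esub> ?S \<in> add_span ?M ?G"
    by (rule add_span_add[rotated])
  then show "X \<in> add_span ?M ?G" by (subst Xeq)
qed


lemma standard_poly_cong:
  assumes "\<And>i. i \<in> {1..k} \<Longrightarrow> x i = y i" "x \<in> {1..k} \<rightarrow> carrier R"
  shows "standard_poly R k x = standard_poly R k y"
  unfolding standard_poly_eq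
proof (rule finsum_cong'[OF refl])
  let ?L = "[1..<Suc k]"
  have L: "set (map p ?L) = {1..k}" if "p permutes {1..k}" for p
    using permutes_image[OF that] by (simp add: atLeastLessThanSuc_atLeastAtMost del: upt_Suc)
  have e: "word_prod R x (map p ?L) = word_prod R y (map p ?L)" if p: "p permutes {1..k}" for p
    by (rule word_prod_cong) (use assms(1) L[OF p] in blast)
  show "[sign p] \<cdot> word_prod R x (map p ?L) = [sign p] \<cdot> word_prod R y (map p ?L)"
    if "p \<in> {p. p permutes {1..k}}" for p
    using e that by simp
  have "word_prod R x (map p ?L) \<in> carrier R" if p: "p permutes {1..k}" for p
    by (rule word_prod_closed) (use assms(2) L[OF p] in blast)
  then show "(\<lambda>p. [sign p] \<cdot> word_prod R y (map p ?L)) \<in> {p. p permutes {1..k}} \<rightarrow> carrier R"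
    by (simp add: e del: upt_Suc One_nat_def)
qed

text \<open>Parity is stored in the pairs of \<open>J\<close> and not read off the ring element,
  since the same element, such as zero, may occur with both parities.\<close>

lemma standard_identity_matrix_ring:
  assumes J: "snd ` J \<subseteq> carrier R" "carrier R \<subseteq> add_span R (snd ` J)"
    and comm: "\<And>s t. s \<in> J \<Longrightarrow> t \<in> J \<Longrightarrow>
      snd s \<otimes> snd t = [(if fst s \<and> fst t then - 1 else 1 :: int)] \<cdot> (snd t \<otimes> snd s)"
    and nilpotent: "\<And>l. set l \<subseteq> J \<Longrightarrow> length (filter fst l) > m \<Longrightarrow> word_prod R snd l = \<zero>"
    and n: "n \<ge> 1" and k: "k = 2 * ((n^2 + 1) div 2 + m div 2)"
  shows "standard_identity (matrix_ring n R) k" (is "standard_identity ?M _")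
proof -
  interpret M: ring ?M by (rule ring_matrix_ring)
  define L where "L = [1..<Suc k]"
  have L: "set L = {1..k}" "length L = k" unfolding L_def by auto
  let ?I = "{1..n} \<times> {1..n}"
  let ?G = "{scalar_unit n R c b | c b. c \<in> snd ` J \<and> b \<in> ?I}"
  show ?thesis
  proof (rule M.standard_identity_add_span)
    show G: "?G \<subseteq> carrier ?M" using J(1) scalar_unit_closed by blast
    show "carrier ?M \<subseteq> add_span ?M ?G"
      by (rule carrier_matrix_ring_subset_add_span[OF J n])
    fix x assume x: "x \<in> {1..k} \<rightarrow> ?G"
    have "\<exists>e c b. (e, c) \<in> J \<and> b \<in> ?I \<and> x s = scalar_unit n R c b"
      if s: "s \<in> {1..k}" for s
    proof -
      obtain c b where "c \<in> snd ` J" "b \<in> ?I" "x s = scalar_unit n R c b"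
        using Pi_mem[OF x s] by blast
      moreover from this obtain e where "(e, c) \<in> J" by auto
      ultimately show ?thesis by blast
    qed
    then obtain e c b where ec: "\<And>s. s \<in> {1..k} \<Longrightarrow> (e s, c s) \<in> J"
      and b: "\<And>s. s \<in> {1..k} \<Longrightarrow> b s \<in> ?I"
      and xs: "\<And>s. s \<in> {1..k} \<Longrightarrow> x s = scalar_unit n R (c s) (b s)"
      by metis
    have c: "c s \<in> carrier R" if "s \<in> {1..k}" for s using ec[OF that] J(1) by force
    let ?l = "map (\<lambda>s. (e s, b s)) L"
    have "standard_poly ?M k x = standard_poly ?M k (\<lambda>s. scalar_unit n R (c s) (b s))"
    proof (rule M.standard_poly_cong)
      show "x \<in> {1..k} \<rightarrow> carrier ?M" using Pi_mono[of "{1..k}" "\<lambda>_. ?G" "\<lambda>_. carrier ?M", OF G] x by (rule subsetD)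
    qed (rule xs)
    also have "\<dots> = \<zero>\<^bsub>?M\<^esub>"
    proof (rule matrix_ring_eqI)
      fix i j assume ij: "i \<in> {1..n}" "j \<in> {1..n}"
      have "standard_poly ?M k (\<lambda>s. scalar_unit n R (c s) (b s)) (i, j) =
          [super_alt ?l (\<lambda>u. word_entry n (map snd u) (i, j))] \<cdot> word_prod R c L"
        unfolding L_def
      proof (rule standard_poly_scalar_unit[OF c _ ij])
        show "c s \<otimes> c t = [(if e s \<and> e t then - 1 else 1 :: int)] \<cdot> (c t \<otimes> c s)"
          if "s \<in> {1..k}" "t \<in> {1..k}" for s t
          using comm[OF ec[OF that(1)] ec[OF that(2)]] by simp
      qed
      also have "\<dots> = \<zero>"
      \<comment> \<open>With at most \<open>m\<close> odd scalars the integer factor vanishes; with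
        more, the product of the scalars does.\<close>
      proof (cases "length (filter fst ?l) \<le> m")
        case True
        have "length (filter (Not \<circ> fst) ?l) + length (filter fst ?l) = length ?l"
          using sum_length_filter_compl[of fst ?l] by (simp only: o_def add.commute)
        then have "length (filter (Not \<circ> fst) ?l) + length (filter fst ?l) = 2 * ((n^2 + 1) div 2 + m div 2)"
          by (simp add: L k)
        note parity = standard_degree_parity[OF this True]
        have card: "card ?I = n^2" by (simp add: card_cartesian_product power2_eq_square)
        have "super_alt ?l (\<lambda>u. word_entry n (map snd u) (i, j)) = 0"
        proof (rule super_alt_vanish[where unit_label = "(1, 1)" and L = ?I])
          show "word_entry n (us @ (1, 1) # vs) (i, j) = word_entry n (us @ vs) (i, j)" for us vs
            by (rule word_entry_identity[OF ij(1)])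
          show "snd ` set ?l \<subseteq> ?I" using b by (simp add: L image_image image_subset_iff)
          show "even (length ?l)" by (simp add: L k)
          show "card ?I \<le> Suc (length (filter (Not \<circ> fst) ?l))"
            unfolding card by (rule parity(1))
          show "odd (length (filter fst ?l))" if "card ?I = Suc (length (filter (Not \<circ> fst) ?l))"
            using that unfolding card by (rule parity(2))
        qed (use n in auto)
        then show ?thesis by (simp add: add_pow_int_0)
      next
        case False
        have "word_prod R c L = word_prod R snd (map (\<lambda>s. (e s, c s)) L)"
          by (simp only: word_prod_map o_def snd_conv)
        also have "\<dots> = \<zero>"
        proof (rule nilpotent)
          show "set (map (\<lambda>s. (e s, c s)) L) \<subseteq> J"
            using ec by (simp add: L image_subset_iff)
          show "m < length (filter fst (map (\<lambda>s. (e s, c s)) L))"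
            using False by (simp add: filter_map o_def)
        qed
        finally show ?thesis by (simp add: add.int_pow_one)
      qed
      also have "\<zero> = \<zero>\<^bsub>?M\<^esub> (i, j)" using ij by (simp add: matrix_ring_def)
      finally show "standard_poly ?M k (\<lambda>s. scalar_unit n R (c s) (b s)) (i, j) = \<zero>\<^bsub>?M\<^esub> (i, j)" .
    next
      show "standard_poly ?M k (\<lambda>s. scalar_unit n R (c s) (b s)) \<in> carrier ?M"
        by (intro M.standard_poly_closed Pi_I scalar_unit_closed c)
    qed (rule M.zero_closed)
    finally show "standard_poly ?M k x = \<zero>\<^bsub>?M\<^esub>" .
  qed
qed

end

section \<open>Monomials in the Grassmann algebra\<close>

definition free_monom :: "('a, 'b) ring_scheme \<Rightarrow> 'a \<Rightarrow> 'v list \<Rightarrow> 'v list \<Rightarrow> 'a" where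
  "free_monom R r w = (\<lambda>u. if u = w then r else \<zero>\<^bsub>R\<^esub>)"

lemma free_gen_eq_monom: "free_gen R x = free_monom R \<one>\<^bsub>R\<^esub> [x]"
  by (simp add: free_gen_def free_monom_def)

lemma (in ring) free_monom_closed:
  "r \<in> carrier R \<Longrightarrow> w \<in> lists X \<Longrightarrow> free_monom R r w \<in> carrier (free_algebra R X)"
  by (auto simp: free_algebra_def free_monom_def)

lemma (in ring) free_monom_mult:
  assumes "r \<in> carrier R" "s \<in> carrier R"
  shows "free_monom R r w \<otimes>\<^bsub>free_algebra R X\<^esub> free_monom R s u = free_monom R (r \<otimes> s) (w @ u)"
proof
  fix v
  \<comment> \<open>Only the split after \<open>length w\<close> letters can contribute to the
    convolution.\<close>
  have "(free_monom R r w \<otimes>\<^bsub>free_algebra R X\<^esub> free_monom R s u) v =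
      (\<Oplus>i\<in>{..length v}. if length w = i then if v = w @ u then r \<otimes> s else \<zero> else \<zero>)"
    unfolding free_algebra_def monoid.simps free_monom_def
  proof (rule finsum_cong')
    fix i assume i: "i \<in> {..length v}"
    have "take i v = w \<and> drop i v = u \<longleftrightarrow> length w = i \<and> v = w @ u"
      using i by (auto simp: append_eq_conv_conj)
    then show "(if take i v = w then r else \<zero>) \<otimes> (if drop i v = u then s else \<zero>) =
        (if length w = i then if v = w @ u then r \<otimes> s else \<zero> else \<zero>)"
      using assms by (auto split: if_splits)
  qed (use assms in auto)
  also have "\<dots> = free_monom R (r \<otimes> s) (w @ u) v"
  proof (cases "v = w @ u")
    case True
    then show ?thesis using assms by (subst finsum_singleton) (auto simp: free_monom_def)
  next
    case False
    then show ?thesis by (simp add: free_monom_def)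
  qed
  finally show "(free_monom R r w \<otimes>\<^bsub>free_algebra R X\<^esub> free_monom R s u) v =
      free_monom R (r \<otimes> s) (w @ u) v" .
qed

text \<open>Induction on a finite set containing the support, splitting off the monomial of one word
  at a time.\<close>

lemma (in ring) free_algebra_subset_add_span:
  "carrier (free_algebra R X) \<subseteq>
    add_span (free_algebra R X) {free_monom R r w | r w. r \<in> carrier R \<and> w \<in> lists X}"
    (is "_ \<subseteq> add_span ?F ?G")
proof
  fix f assume f: "f \<in> carrier ?F"
  have "f \<in> add_span ?F ?G" if "finite S" "{w. f w \<noteq> \<zero>} \<subseteq> S" for S
    using that f
  proof (induction S arbitrary: f rule: finite_induct)
    case empty
    then have "f = \<zero>\<^bsub>?F\<^esub>" by (auto simp: free_algebra_def)
    then show ?case by (simp add: add_span_zero)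
  next
    case (insert w S)
    have fw: "f u \<in> carrier R" for u using insert.prems by (auto simp: free_algebra_def)
    show ?case
    proof (cases "f w = \<zero>")
      case True
      then have "{w. f w \<noteq> \<zero>} \<subseteq> S" using insert.prems(1) by auto
      then show ?thesis using insert.prems(2) by (rule insert.IH)
    next
      case False
      let ?g = "f(w := \<zero>)"
      have "w \<in> lists X" using False insert.prems(2) by (auto simp: free_algebra_def)
      then have monom: "free_monom R (f w) w \<in> add_span ?F ?G"
        using fw by (intro add_span_gen) blast
      have supp: "{w. ?g w \<noteq> \<zero>} \<subseteq> S" using insert.prems(1) by auto
      then have "finite {w. ?g w \<noteq> \<zero>}" using insert.hyps(1) by (rule finite_subset)
      then have "?g \<in> carrier ?F" using insert.prems(2) by (auto simp: free_algebra_def)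
      with supp have g: "?g \<in> add_span ?F ?G" by (rule insert.IH)
      have f_eq: "f = free_monom R (f w) w \<oplus>\<^bsub>?F\<^esub> ?g"
        using fw by (auto simp: free_algebra_def free_monom_def)
      show ?thesis by (subst f_eq) (rule add_span_add[OF monom g])
    qed
  qed
  moreover have "finite {w. f w \<noteq> \<zero>}" using f by (auto simp: free_algebra_def)
  ultimately show "f \<in> add_span ?F ?G" by blast
qed

lemma image_setcompr2: "f ` {g r w | r w. P r w} = {f (g r w) | r w. P r w}"
  by blast

lemma add_span_hom_image:
  assumes "ring F" "ring E" "h \<in> ring_hom F E" "G \<subseteq> carrier F" "a \<in> add_span F G"
  shows "h a \<in> add_span E (h ` G)"
  using assms(5)
proof induction
  case add_span_zero
  then show ?case
    using ring_hom_zero[OF assms(3,1,2)] by (simp add: add_span.add_span_zero)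
next
  case (add_span_gen g)
  then show ?case by (intro add_span.add_span_gen imageI)
next
  case (add_span_add a b)
  then show ?case
    using ring.add_span_closed[OF assms(1,4)] ring_hom_add[OF assms(3)]
    by (simp add: add_span.add_span_add)
qed

definition grassmann_monom :: "('a, 'b) ring_scheme \<Rightarrow> nat \<Rightarrow> 'a \<Rightarrow> nat list \<Rightarrow> (nat list \<Rightarrow> 'a) set" where
  "grassmann_monom R m r w =
    (let F = free_algebra R {1..m} in Idl\<^bsub>F\<^esub> (grassmann_relations R m) +>\<^bsub>F\<^esub> free_monom R r w)"

context cring
begin

context
  fixes m :: nat
  notes [simp del] = One_nat_def
begin

private abbreviation "F \<equiv> free_algebra R {1..m}"
private abbreviation "E \<equiv> grassmann_algebra R m"
private abbreviation "I \<equiv> Idl\<^bsub>F\<^esub> (grassmann_relations R m)"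

interpretation F: ring F by (rule ring_free_algebra)
interpretation E: ring E by (rule ring_grassmann_algebra)
interpretation I: ideal I F by (rule F.genideal_ideal[OF grassmann_relations_closed])

lemma grassmann_monom_eq: "grassmann_monom R m r w = I +>\<^bsub>F\<^esub> free_monom R r w"
  by (simp add: grassmann_monom_def Let_def)

lemma coset_hom: "(+>\<^bsub>F\<^esub>) I \<in> ring_hom F E"
  unfolding grassmann_algebra_def by (rule I.rcos_ring_hom)

lemma grassmann_monom_closed [simp]:
  "r \<in> carrier R \<Longrightarrow> w \<in> lists {1..m} \<Longrightarrow> grassmann_monom R m r w \<in> carrier E"
  unfolding grassmann_monom_eq by (intro ring_hom_closed[OF coset_hom] free_monom_closed)

lemma grassmann_monom_mult:
  assumes "r \<in> carrier R" "s \<in> carrier R" "w \<in> lists {1..m}" "u \<in> lists {1..m}"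
  shows "grassmann_monom R m r w \<otimes>\<^bsub>E\<^esub> grassmann_monom R m s u = grassmann_monom R m (r \<otimes> s) (w @ u)"
  unfolding grassmann_monom_eq
  using ring_hom_mult[OF coset_hom free_monom_closed free_monom_closed, of r w s u] assms
  by (simp add: free_monom_mult)

lemma grassmann_monom_one: "\<one>\<^bsub>E\<^esub> = grassmann_monom R m \<one> []"
  using ring_hom_one[OF coset_hom]
  by (simp add: grassmann_monom_eq free_monom_def free_algebra_def)

lemma grassmann_algebra_subset_add_span:
  "carrier E \<subseteq> add_span E {grassmann_monom R m r w | r w. r \<in> carrier R \<and> w \<in> lists {1..m}}"
proof
  let ?G = "{free_monom R r w | r w. r \<in> carrier R \<and> w \<in> lists {1..m}}"
  fix a assume "a \<in> carrier E"
  then have "a \<in> a_rcosets\<^bsub>F\<^esub> I" by (simp only: grassmann_algebra_def FactRing_def partial_object.simps)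
  then obtain f where f: "f \<in> carrier F" "a = I +>\<^bsub>F\<^esub> f"
    unfolding A_RCOSETS_def' by blast
  have G: "?G \<subseteq> carrier F" by (auto intro: free_monom_closed simp del: in_lists_conv_set)
  have "f \<in> add_span F ?G" using f(1) free_algebra_subset_add_span by (rule subsetD[rotated])
  then have "I +>\<^bsub>F\<^esub> f \<in> add_span E ((+>\<^bsub>F\<^esub>) I ` ?G)"
    by (rule add_span_hom_image[OF F.ring_axioms E.ring_axioms coset_hom G])
  also have "(+>\<^bsub>F\<^esub>) I ` ?G = {grassmann_monom R m r w | r w. r \<in> carrier R \<and> w \<in> lists {1..m}}"
    unfolding grassmann_monom_eq by (rule image_setcompr2)
  finally show "a \<in> add_span E {grassmann_monom R m r w | r w. r \<in> carrier R \<and> w \<in> lists {1..m}}"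
    unfolding f(2) .
qed

section \<open>Consequences of the defining relations\<close>

lemma coset_eq_zero: "a \<in> I \<Longrightarrow> I +>\<^bsub>F\<^esub> a = \<zero>\<^bsub>E\<^esub>"
  by (simp add: grassmann_algebra_def FactRing_def I.a_rcos_const)

text \<open>This carries a relation between generators over to monomials with arbitrary letters on
  both sides; the coefficient is placed on the left factor.\<close>

lemma sandwich_in_ideal:
  assumes "a \<in> grassmann_relations R m" "r \<in> carrier R" "u \<in> lists {1..m}" "v \<in> lists {1..m}"
  shows "free_monom R r u \<otimes>\<^bsub>F\<^esub> (a \<otimes>\<^bsub>F\<^esub> free_monom R \<one> v) \<in> I"
proof (rule I.I_l_closed[OF I.I_r_closed])
  show "a \<in> I" using F.genideal_self[OF grassmann_relations_closed] assms(1) by (rule subsetD)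
qed (use assms in \<open>auto intro!: free_monom_closed\<close>)

lemma grassmann_monom_square:
  assumes "r \<in> carrier R" "i \<in> {1..m}" "u \<in> lists {1..m}" "v \<in> lists {1..m}"
  shows "grassmann_monom R m r (u @ i # i # v) = \<zero>\<^bsub>E\<^esub>"
proof -
  let ?v = "free_gen R :: nat \<Rightarrow> _"
  have "?v i \<otimes>\<^bsub>F\<^esub> ?v i \<in> grassmann_relations R m"
    using assms(2) by (auto simp: grassmann_relations_def Let_def)
  from sandwich_in_ideal[OF this assms(1,3,4)]
  have "free_monom R r (u @ i # i # v) \<in> I"
    using assms by (simp add: free_gen_eq_monom free_monom_mult)
  then show ?thesis unfolding grassmann_monom_eq by (rule coset_eq_zero)
qed

lemma grassmann_monom_swap_less:
  assumes "r \<in> carrier R" "i \<in> {1..m}" "j \<in> {1..m}" "u \<in> lists {1..m}" "v \<in> lists {1..m}" "i < j"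
  shows "grassmann_monom R m r (u @ i # j # v) \<oplus>\<^bsub>E\<^esub> grassmann_monom R m r (u @ j # i # v) = \<zero>\<^bsub>E\<^esub>"
proof -
  let ?v = "free_gen R :: nat \<Rightarrow> _"
  have "?v i \<otimes>\<^bsub>F\<^esub> ?v j \<oplus>\<^bsub>F\<^esub> ?v j \<otimes>\<^bsub>F\<^esub> ?v i \<in> grassmann_relations R m"
    unfolding grassmann_relations_def Let_def
    by (intro UnI2 CollectI exI[of _ i] exI[of _ j]) (use assms in simp)
  from sandwich_in_ideal[OF this assms(1,4,5)]
  have "free_monom R r u \<otimes>\<^bsub>F\<^esub> ((free_monom R \<one> [i, j] \<oplus>\<^bsub>F\<^esub> free_monom R \<one> [j, i]) \<otimes>\<^bsub>F\<^esub> free_monom R \<one> v) \<in> I"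
    by (simp add: free_gen_eq_monom free_monom_mult)
  moreover have cl: "free_monom R s w \<in> carrier F" if "s \<in> carrier R" "w \<in> lists {1..m}" for s w
    using that by (rule free_monom_closed)
  have "free_monom R r u \<otimes>\<^bsub>F\<^esub> ((free_monom R \<one> [i, j] \<oplus>\<^bsub>F\<^esub> free_monom R \<one> [j, i]) \<otimes>\<^bsub>F\<^esub> free_monom R \<one> v) =
     free_monom R r (u @ i # j # v) \<oplus>\<^bsub>F\<^esub> free_monom R r (u @ j # i # v)"
    using assms cl[of \<one> v] cl[of r u] cl[of \<one> "[i, j]"] cl[of \<one> "[j, i]"]
      cl[of \<one> "[i, j] @ v"] cl[of \<one> "[j, i] @ v"]
    by (simp add: F.l_distr F.r_distr free_monom_mult)
  ultimately have "I +>\<^bsub>F\<^esub> (free_monom R r (u @ i # j # v) \<oplus>\<^bsub>F\<^esub> free_monom R r (u @ j # i # v)) = \<zero>\<^bsub>E\<^esub>"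
    using coset_eq_zero by simp
  moreover have "u @ i # j # v \<in> lists {1..m}" "u @ j # i # v \<in> lists {1..m}"
    using assms by auto
  ultimately show ?thesis
    using ring_hom_add[OF coset_hom cl[OF assms(1)] cl[OF assms(1)]]
    by (simp add: grassmann_monom_eq)
qed

text \<open>The anticommutation relations cover \<open>i < j\<close>. For \<open>j < i\<close> the
  same two terms are added in the other order, and for equal indices both vanish by the square
  relation.\<close>

lemma grassmann_monom_swap:
  assumes "r \<in> carrier R" "i \<in> {1..m}" "j \<in> {1..m}" "u \<in> lists {1..m}" "v \<in> lists {1..m}"
  shows "grassmann_monom R m r (u @ i # j # v) = \<ominus>\<^bsub>E\<^esub> grassmann_monom R m r (u @ j # i # v)"
proof -
  have cl: "grassmann_monom R m r (u @ i # j # v) \<in> carrier E"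
    "grassmann_monom R m r (u @ j # i # v) \<in> carrier E"
    using assms by auto
  consider "i < j" | "j < i" | "i = j" by linarith
  then have "grassmann_monom R m r (u @ i # j # v) \<oplus>\<^bsub>E\<^esub> grassmann_monom R m r (u @ j # i # v) = \<zero>\<^bsub>E\<^esub>"
  proof cases
    case 1
    then show ?thesis using assms by (intro grassmann_monom_swap_less)
  next
    case 2
    then show ?thesis
      unfolding E.a_comm[OF cl] using assms by (intro grassmann_monom_swap_less)
  next
    case 3
    then show ?thesis using assms grassmann_monom_square by simp
  qed
  then show ?thesis using cl by (intro E.minus_equality[symmetric])
qed

text \<open>The prefix \<open>t\<close> is arbitrary because each induction step appends to it the
  letter just passed.\<close>

lemma grassmann_monom_move:
  assumes "r \<in> carrier R" "i \<in> {1..m}" "t \<in> lists {1..m}" "u \<in> lists {1..m}" "v \<in> lists {1..m}"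
  shows "grassmann_monom R m r (t @ i # u @ v) =
    [((- 1 :: int) ^ length u)] \<cdot>\<^bsub>E\<^esub> grassmann_monom R m r (t @ u @ i # v)"
  using assms(3,4)
proof (induction u arbitrary: t)
  case Nil
  then show ?case using assms by (simp add: grassmann_monom_closed[unfolded in_lists_conv_set])
next
  case (Cons j u)
  let ?q = "grassmann_monom R m r"
  have cl: "?q (t @ j # u @ i # v) \<in> carrier E" "?q (t @ j # i # u @ v) \<in> carrier E"
    using assms Cons.prems by auto
  have "?q (t @ i # j # u @ v) = \<ominus>\<^bsub>E\<^esub> ?q (t @ j # i # u @ v)"
    using assms Cons.prems by (intro grassmann_monom_swap) auto
  also have "\<dots> = [(- 1 :: int)] \<cdot>\<^bsub>E\<^esub> ?q (t @ j # i # u @ v)"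
    using cl by (simp add: E.add.int_pow_neg)
  also have "?q (t @ j # i # u @ v) = [((- 1 :: int) ^ length u)] \<cdot>\<^bsub>E\<^esub> ?q (t @ j # u @ i # v)"
    using Cons.IH[of "t @ [j]"] Cons.prems by simp
  finally show ?case using cl by (simp add: E.add_pow_add_pow)
qed

lemma grassmann_monom_swap_blocks:
  assumes "r \<in> carrier R" "t \<in> lists {1..m}" "w \<in> lists {1..m}" "u \<in> lists {1..m}"
  shows "grassmann_monom R m r (t @ w @ u) =
    [((- 1 :: int) ^ (length w * length u))] \<cdot>\<^bsub>E\<^esub> grassmann_monom R m r (t @ u @ w)"
  using assms(2,3)
proof (induction w arbitrary: t)
  case Nil
  then show ?case using assms by (simp add: grassmann_monom_closed[unfolded in_lists_conv_set])
next
  case (Cons i w)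
  let ?q = "grassmann_monom R m r"
  have cl: "?q (t @ u @ i # w) \<in> carrier E"
    using assms Cons.prems by auto
  have "?q (t @ i # w @ u) = [((- 1 :: int) ^ (length w * length u))] \<cdot>\<^bsub>E\<^esub> ?q (t @ i # u @ w)"
    using Cons.IH[of "t @ [i]"] Cons.prems by simp
  also have "?q (t @ i # u @ w) = [((- 1 :: int) ^ length u)] \<cdot>\<^bsub>E\<^esub> ?q (t @ u @ i # w)"
    using assms Cons.prems by (intro grassmann_monom_move) auto
  finally show ?case using cl by (simp add: E.add_pow_add_pow power_add mult.commute)
qed

text \<open>Exchanging the two blocks takes \<open>length w * length u\<close> swaps of generators,
  an odd number only if both lengths are odd. The coefficients change places by commutativity of
  \<open>R\<close>.\<close>

lemma grassmann_monom_commute: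
  assumes "r \<in> carrier R" "s \<in> carrier R" "w \<in> lists {1..m}" "u \<in> lists {1..m}"
  shows "grassmann_monom R m r w \<otimes>\<^bsub>E\<^esub> grassmann_monom R m s u =
    [(if odd (length w) \<and> odd (length u) then - 1 else 1 :: int)] \<cdot>\<^bsub>E\<^esub>
      (grassmann_monom R m s u \<otimes>\<^bsub>E\<^esub> grassmann_monom R m r w)"
proof -
  have "(- 1 :: int) ^ (length w * length u) = (if odd (length w) \<and> odd (length u) then - 1 else 1)"
    by (simp add: minus_one_power_iff)
  then show ?thesis
    using grassmann_monom_swap_blocks[of "r \<otimes> s" "[]" w u] assms
    by (simp add: grassmann_monom_mult m_comm)
qed

text \<open>A repeated generator can be moved next to its other occurrence, where the square
  relation applies.\<close>

lemma grassmann_monom_not_distinct: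
  assumes "r \<in> carrier R" "w \<in> lists {1..m}" "\<not> distinct w"
  shows "grassmann_monom R m r w = \<zero>\<^bsub>E\<^esub>"
proof -
  obtain t i u v where w: "w = t @ [i] @ u @ [i] @ v"
    using not_distinct_decomp[OF assms(3)] by blast
  have "grassmann_monom R m r (t @ i # u @ i # v) =
      [((- 1 :: int) ^ length u)] \<cdot>\<^bsub>E\<^esub> grassmann_monom R m r ((t @ u) @ i # i # v)"
    using assms w grassmann_monom_move[of r i t u "i # v"] by simp
  also have "grassmann_monom R m r ((t @ u) @ i # i # v) = \<zero>\<^bsub>E\<^esub>"
    using assms w by (intro grassmann_monom_square) auto
  finally show ?thesis by (simp add: w E.add.int_pow_one)
qed

text \<open>A factor marked odd has a word of odd length and so contributes at least one letter to
  the combined word.\<close>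

lemma word_prod_grassmann_monom:
  assumes "set l \<subseteq> {(odd (length w), grassmann_monom R m r w) | r w. r \<in> carrier R \<and> w \<in> lists {1..m}}"
  shows "\<exists>r w. r \<in> carrier R \<and> w \<in> lists {1..m} \<and> length (filter fst l) \<le> length w \<and>
    word_prod E snd l = grassmann_monom R m r w"
  using assms
proof (induction l)
  case Nil
  then show ?case by (intro exI[of _ \<one>] exI[of _ "[]"]) (simp add: grassmann_monom_one)
next
  case (Cons a l)
  then obtain r w where rw: "r \<in> carrier R" "w \<in> lists {1..m}" "length (filter fst l) \<le> length w"
    "word_prod E snd l = grassmann_monom R m r w" by auto
  obtain s u where su: "s \<in> carrier R" "u \<in> lists {1..m}" "a = (odd (length u), grassmann_monom R m s u)"
    using Cons.prems by auto
  have "word_prod E snd (a # l) = grassmann_monom R m (s \<otimes> r) (u @ w)"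
    using rw su by (simp add: grassmann_monom_mult)
  moreover have "length (filter fst (a # l)) \<le> length (u @ w)"
    using rw(3) su(3) by (cases u) auto
  moreover have "s \<otimes> r \<in> carrier R" "u @ w \<in> lists {1..m}" using rw su by auto
  ultimately show ?case by blast
qed

end

end

theorem corollary7:
  fixes R :: "('a, 'b) ring_scheme" and m n :: nat
  assumes "cring R" and "n \<ge> 1"
  shows "standard_identity (matrix_ring n (grassmann_algebra R m))
           (2 * ((n^2 + 1) div 2 + m div 2))"
proof -
  interpret R: cring R by fact
  let ?E = "grassmann_algebra R m"
  interpret E: ring ?E by (rule R.ring_grassmann_algebra)
  \<comment> \<open>Monomials are taken with all coefficients, so that their sums exhaust the
    algebra; the parity is that of the word length.\<close>
  let ?J = "{(odd (length w), grassmann_monom R m r w) | r w. r \<in> carrier R \<and> w \<in> lists {1..m}}"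
  have J: "snd ` ?J = {grassmann_monom R m r w | r w. r \<in> carrier R \<and> w \<in> lists {1..m}}"
    by (simp only: image_setcompr2 snd_conv)
  show ?thesis
  proof (rule E.standard_identity_matrix_ring[where J = ?J and m = m])
    show "snd ` ?J \<subseteq> carrier ?E" unfolding J
      by (auto intro: R.grassmann_monom_closed simp del: in_lists_conv_set)
    show "carrier ?E \<subseteq> add_span ?E (snd ` ?J)"
      unfolding J by (rule R.grassmann_algebra_subset_add_span)
    show "snd s \<otimes>\<^bsub>?E\<^esub> snd t =
        [(if fst s \<and> fst t then - 1 else 1 :: int)] \<cdot>\<^bsub>?E\<^esub> (snd t \<otimes>\<^bsub>?E\<^esub> snd s)"
      if st: "s \<in> ?J" "t \<in> ?J" for s t
    proof -
      obtain r w where rw: "s = (odd (length w), grassmann_monom R m r w)"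
        "r \<in> carrier R" "w \<in> lists {1..m}" using st(1) by blast
      obtain r' u where ru: "t = (odd (length u), grassmann_monom R m r' u)"
        "r' \<in> carrier R" "u \<in> lists {1..m}" using st(2) by blast
      show ?thesis
        unfolding rw(1) ru(1) fst_conv snd_conv
        by (rule R.grassmann_monom_commute[OF rw(2) ru(2) rw(3) ru(3)])
    qed
    show "word_prod ?E snd l = \<zero>\<^bsub>?E\<^esub>" if l: "set l \<subseteq> ?J" "m < length (filter fst l)" for l
    proof -
      obtain r w where rw: "r \<in> carrier R" "w \<in> lists {1..m}" "length (filter fst l) \<le> length w"
        "word_prod ?E snd l = grassmann_monom R m r w"
        using R.word_prod_grassmann_monom[OF l(1)] by blast
      \<comment> \<open>A word without repetition in \<open>m\<close> generators has at most
        \<open>m\<close> letters, but \<open>w\<close> has at least as many letters as there are odd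
        factors.\<close>
      have "\<not> distinct w"
      proof
        assume "distinct w"
        then have "length w = card (set w)" by (simp add: distinct_card)
        also have "\<dots> \<le> m" using rw(2) card_mono[of "{1..m}" "set w"] by (simp add: in_lists_conv_set subset_iff)
        finally show False using rw(3) l(2) by simp
      qed
      then show ?thesis using R.grassmann_monom_not_distinct rw by simp
    qed
  qed (use assms(2) in simp_all)
qed

end
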